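(* Let $q=p^r$ be a prime power ($p$ prime), let $M$ be chosen uniformly at random from $\mathrm{GL}(n,\mathbb{F}_q)$, and let $1\le k\le n$. For any elements $a_i\in\mathbb{F}_q$ indexed by the integers $1\le i\le k$ with $p\nmid i$, $$\left|\mathbb{P}_{M\in\mathrm{GL}(n,\mathbb{F}_q)}\big(\forall\,1\le i\le k \text{ with } p\nmid i:\ \mathrm{Tr}(M^i)=a_i\big)-\frac{1}{q^{k-\lfloor k/p\rfloor}}\right|\le\frac{(k+1)\,q^{\lfloor k/p\rfloor}}{q^n}.$$
   Context: "Uniformly at random" is Haar probability measure on the finite group $\mathrm{GL}(n,\mathbb{F}_q)$ of invertible $n\times n$ matrices over $\mathbb{F}_q$. *)

theory Defs
  imports "Jordan_Normal_Form.Matrix" "HOL-Library.Cardinality" Complex_Main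
begin

definition mat_trace :: "'a :: comm_ring_1 mat \<Rightarrow> 'a" where
  "mat_trace A = (\<Sum>i<dim_row A. A $$ (i, i))"

definition GL :: "nat \<Rightarrow> 'a :: field mat set" where
  "GL n = {M \<in> carrier_mat n n. invertible_mat M}"

end

theory Submission
  imports Defs "Jordan_Normal_Form.Determinant"
begin

text \<open>Fix a vector \<open>v \<noteq> 0\<close> and let \<open>d\<close> be the dimension of the cyclic subspace generated from \<open>v\<close> by
  a uniform \<open>M \<in> GL n\<close>. In an adapted basis \<open>M\<close> is block upper triangular, with a \<open>d \<times> d\<close> companion
  block \<open>C\<close> and a block \<open>D \<in> GL (n - d)\<close>, and double counting pairs of \<open>M\<close> and such bases shows that,
  up to the common factor \<open>1 / (q ^ n - 1)\<close>, every invertible companion matrix of every size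
  \<open>1 \<le> d \<le> n\<close> has the same weight while \<open>D\<close> is uniform. Since \<open>Tr (M ^ i) = Tr (C ^ i) + Tr (D ^ i)\<close>
  and \<open>Tr (C ^ i)\<close> is \<open>i\<close> times the \<open>i\<close>-th coefficient of \<open>C\<close> plus a function of the earlier ones, the
  prescribed traces hold with exactly the expected frequency when \<open>d > k\<close>, and for at most
  \<open>q ^ (d div p)\<close> companion matrices, given \<open>D\<close>, when \<open>d \<le> k\<close>.\<close>

section \<open>The general linear group\<close>

text \<open>A choice of two-sided inverse, meaningful for invertible \<open>M\<close>. The size is
  read off from \<open>dim_row M\<close>, so no dimension argument has to be carried along.\<close>

definition gl_inv :: "'a :: field mat \<Rightarrow> 'a mat" where
  "gl_inv M = (SOME Q. Q \<in> carrier_mat (dim_row M) (dim_row M)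
     \<and> M * Q = 1\<^sub>m (dim_row M) \<and> Q * M = 1\<^sub>m (dim_row M))"

lemma GL_carrier: "M \<in> GL n \<Longrightarrow> M \<in> carrier_mat n n"
  by (simp add: GL_def)

lemma GL_I:
  assumes "M \<in> carrier_mat n n" "Q \<in> carrier_mat n n" "M * Q = 1\<^sub>m n"
  shows "M \<in> GL n"
proof -
  have "Q * M = 1\<^sub>m n" using mat_mult_left_right_inverse assms by blast
  then show ?thesis using assms by (auto simp: GL_def invertible_mat_def inverts_mat_def)
qed

lemma
  assumes "M \<in> GL n"
  shows gl_inv_carrier: "gl_inv M \<in> carrier_mat n n"
    and gl_inv_right: "M * gl_inv M = 1\<^sub>m n"
    and gl_inv_left: "gl_inv M * M = 1\<^sub>m n"
proof -
  have M: "M \<in> carrier_mat n n" using GL_carrier assms .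
  obtain B where B: "M * B = 1\<^sub>m (dim_row M)" "B * M = 1\<^sub>m (dim_row B)"
    using assms by (auto simp: GL_def invertible_mat_def inverts_mat_def)
  \<comment> \<open>\<open>invertible_mat\<close> does not fix the shape of \<open>B\<close>;
    comparing the sizes of both sides of the two identities does.\<close>
  have "dim_col (M * B) = n" using B M by simp
  moreover have "dim_col (B * M) = dim_row B" using B by simp
  ultimately have "B \<in> carrier_mat n n" using M by auto
  then have "\<exists>Q. Q \<in> carrier_mat (dim_row M) (dim_row M)
     \<and> M * Q = 1\<^sub>m (dim_row M) \<and> Q * M = 1\<^sub>m (dim_row M)"
    using B M by auto
  from someI_ex[OF this, folded gl_inv_def] show
    "gl_inv M \<in> carrier_mat n n" "M * gl_inv M = 1\<^sub>m n" "gl_inv M * M = 1\<^sub>m n"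
    using M by auto
qed

lemma gl_inv_in_GL: "M \<in> GL n \<Longrightarrow> gl_inv M \<in> GL n"
  by (metis GL_I GL_carrier gl_inv_carrier gl_inv_left)

lemma one_in_GL: "1\<^sub>m n \<in> GL n"
  by (rule GL_I[of _ _ "1\<^sub>m n"]) auto

lemma mult_in_GL:
  assumes "A \<in> GL n" "B \<in> GL n"
  shows "A * B \<in> GL n"
proof -
  note c = assms[THEN GL_carrier] assms[THEN gl_inv_carrier]
  have "A * B * (gl_inv B * gl_inv A) = A * (B * gl_inv B) * gl_inv A"
    using c by (simp add: assoc_mult_mat[of _ n n _ n _ n])
  also have "\<dots> = 1\<^sub>m n" using c assms by (simp add: gl_inv_right)
  finally show ?thesis using c by (intro GL_I) auto
qed

lemma GL_iff_det: "M \<in> GL n \<longleftrightarrow> M \<in> carrier_mat n n \<and> det M \<noteq> 0"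
proof
  assume M: "M \<in> GL n"
  have "det M * det (gl_inv M) = 1"
    using M det_mult[of M n "gl_inv M"] by (simp add: GL_carrier gl_inv_carrier gl_inv_right)
  then show "M \<in> carrier_mat n n \<and> det M \<noteq> 0" using GL_carrier[OF M] by auto
next
  assume M: "M \<in> carrier_mat n n \<and> det M \<noteq> 0"
  then have "M \<in> Units (ring_mat TYPE('a) n undefined)"
    by (intro det_non_zero_imp_unit) auto
  then show "M \<in> GL n" using GL_I unfolding Units_def ring_mat_def by auto
qed

lemma GL_iff_kernel:
  "M \<in> GL n \<longleftrightarrow> M \<in> carrier_mat n n \<and> (\<forall>v\<in>carrier_vec n. M *\<^sub>v v = 0\<^sub>v n \<longrightarrow> v = 0\<^sub>v n)"
  using det_0_iff_vec_prod_zero_field[of M n] by (auto simp: GL_iff_det)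

lemma gl_inv_mult_vec:
  assumes "M \<in> GL n" "x \<in> carrier_vec n"
  shows "gl_inv M *\<^sub>v (M *\<^sub>v x) = x" "M *\<^sub>v (gl_inv M *\<^sub>v x) = x"
proof -
  note c = GL_carrier[OF assms(1)] gl_inv_carrier[OF assms(1)] assms(2)
  show "gl_inv M *\<^sub>v (M *\<^sub>v x) = x" "M *\<^sub>v (gl_inv M *\<^sub>v x) = x"
    using c assms(1) by (simp_all flip: assoc_mult_mat_vec add: gl_inv_left gl_inv_right)
qed

section \<open>Columns, finiteness of matrix spaces and the number of vectors\<close>

lemma mult_unit_vec:
  fixes A :: "'a :: semiring_1 mat"
  assumes "A \<in> carrier_mat r n" "j < n"
  shows "A *\<^sub>v unit_vec n j = col A j"
  using assms by (intro eq_vecI) auto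

lemma finite_carrier_mat: "finite (carrier_mat r c :: 'a :: finite mat set)"
proof (rule finite_surj)
  show "finite (PiE ({..<r} \<times> {..<c}) (\<lambda>_. UNIV :: 'a set))"
    by (intro finite_PiE) auto
  show "carrier_mat r c \<subseteq> mat r c ` (PiE ({..<r} \<times> {..<c}) (\<lambda>_. UNIV :: 'a set))"
  proof
    fix A :: "'a mat" assume A: "A \<in> carrier_mat r c"
    let ?f = "restrict (\<lambda>ij. A $$ ij) ({..<r} \<times> {..<c})"
    show "A \<in> mat r c ` (PiE ({..<r} \<times> {..<c}) (\<lambda>_. UNIV))"
    proof (rule image_eqI[where x = ?f])
      show "A = mat r c ?f" using A by (intro eq_matI) auto
    qed (simp only: restrict_PiE_iff, simp)
  qed
qed

lemma finite_GL: "finite (GL n :: 'a :: {field, finite} mat set)"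
  by (rule finite_subset[OF _ finite_carrier_mat[of n n]]) (simp add: GL_def subset_iff)

lemma card_carrier_vec: "card (carrier_vec n :: 'a :: finite vec set) = CARD('a) ^ n"
proof -
  let ?F = "PiE {..<n} (\<lambda>_. UNIV :: 'a set)"
  have bij: "bij_betw (vec n) ?F (carrier_vec n)"
  proof (rule bij_betw_imageI)
    show "inj_on (vec n) ?F"
    proof (rule inj_onI)
      fix f g assume fg: "f \<in> ?F" "g \<in> ?F" and eq: "vec n f = vec n g"
      have "f i = g i" if "i < n" for i
        using arg_cong[OF eq, of "\<lambda>v. v $ i"] that by simp
      then show "f = g" using fg by (intro PiE_ext) auto
    qed
    show "vec n ` ?F = carrier_vec n"
    proof (intro equalityI subsetI)
      fix v :: "'a vec" assume v: "v \<in> carrier_vec n"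
      show "v \<in> vec n ` ?F"
      proof (rule image_eqI[where x = "restrict (($) v) {..<n}"])
        show "v = vec n (restrict (($) v) {..<n})" using v by (intro eq_vecI) auto
      qed (simp only: restrict_PiE_iff, simp)
    qed (erule imageE, simp)
  qed
  have "card ?F = CARD('a) ^ n" by (simp add: card_PiE)
  then show "card (carrier_vec n :: 'a vec set) = CARD('a) ^ n"
    by (rule trans[OF bij_betw_same_card[OF bij, symmetric]])
qed

section \<open>Traces\<close>

lemma mat_trace_comm:
  assumes "A \<in> carrier_mat n m" "B \<in> carrier_mat m n"
  shows "mat_trace (A * B) = mat_trace (B * A)"
proof -
  have "mat_trace (A * B) = (\<Sum>i<n. \<Sum>j<m. A $$ (i,j) * B $$ (j,i))"
    using assms by (auto simp: mat_trace_def scalar_prod_def atLeast0LessThan intro!: sum.cong)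
  also have "\<dots> = (\<Sum>j<m. \<Sum>i<n. B $$ (j,i) * A $$ (i,j))"
    by (subst sum.swap) (simp add: mult.commute)
  also have "\<dots> = mat_trace (B * A)"
    using assms by (auto simp: mat_trace_def scalar_prod_def atLeast0LessThan intro!: sum.cong)
  finally show ?thesis .
qed

text \<open>Powers commute with conjugation, and cyclicity of the trace cancels \<open>P\<close>
  against its inverse.\<close>

lemma mat_trace_conj_pow:
  fixes N :: "'a :: field mat"
  assumes "N \<in> carrier_mat n n" "P \<in> GL n"
  shows "mat_trace ((P * N * gl_inv P) ^\<^sub>m i) = mat_trace (N ^\<^sub>m i)"
proof -
  note c = assms(1) GL_carrier[OF assms(2)] gl_inv_carrier[OF assms(2)]
  have "similar_mat_wit (P * N * gl_inv P) N P (gl_inv P)"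
    using c gl_inv_left[OF assms(2)] gl_inv_right[OF assms(2)] 
    by (auto simp: similar_mat_wit_def Let_def)
  then have "(P * N * gl_inv P) ^\<^sub>m i = P * N ^\<^sub>m i * gl_inv P"
    by (rule similar_mat_wit_pow_id)
  also have "mat_trace \<dots> = mat_trace (gl_inv P * (P * N ^\<^sub>m i))"
    using c by (intro mat_trace_comm[of _ n n]) auto
  also have "gl_inv P * (P * N ^\<^sub>m i) = gl_inv P * P * N ^\<^sub>m i"
    using c by (simp add: assoc_mult_mat[of _ n n _ n _ n])
  also have "\<dots> = N ^\<^sub>m i" using c gl_inv_left[OF assms(2)] by simp
  finally show ?thesis .
qed

lemma mat_trace_four_block:
  assumes "A \<in> carrier_mat d d" "D \<in> carrier_mat m m"
  shows "mat_trace (four_block_mat A B C D) = mat_trace A + mat_trace D"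
proof -
  have split: "(\<Sum>i<d+m. f i) = (\<Sum>i<d. f i) + (\<Sum>i<m. f (d + i))" for f :: "nat \<Rightarrow> 'a"
    by (induction m) (simp_all add: add.assoc)
  show ?thesis
    using assms by (simp add: mat_trace_def split)
qed

text \<open>Traces see only the diagonal blocks, so the upper right block of the power is left
  existential.\<close>

lemma four_block_upper_pow:
  fixes A :: "'a :: comm_ring_1 mat"
  assumes "A \<in> carrier_mat d d" "B \<in> carrier_mat d m" "D \<in> carrier_mat m m"
  shows "\<exists>B'\<in>carrier_mat d m.
    four_block_mat A B (0\<^sub>m m d) D ^\<^sub>m i = four_block_mat (A ^\<^sub>m i) B' (0\<^sub>m m d) (D ^\<^sub>m i)"
proof (induction i)
  case 0
  show ?case using assms by (intro bexI[of _ "0\<^sub>m d m"]) auto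
next
  case (Suc i)
  then obtain B' where B': "B' \<in> carrier_mat d m"
    "four_block_mat A B (0\<^sub>m m d) D ^\<^sub>m i = four_block_mat (A ^\<^sub>m i) B' (0\<^sub>m m d) (D ^\<^sub>m i)"
    by auto
  have "four_block_mat A B (0\<^sub>m m d) D ^\<^sub>m Suc i
      = four_block_mat (A ^\<^sub>m i * A + B' * 0\<^sub>m m d) (A ^\<^sub>m i * B + B' * D)
          (0\<^sub>m m d * A + D ^\<^sub>m i * 0\<^sub>m m d) (0\<^sub>m m d * B + D ^\<^sub>m i * D)"
    using assms B' by (simp add: mult_four_block_mat[of _ d d _ m _ m _ _ d _ m])
  also have "\<dots> = four_block_mat (A ^\<^sub>m Suc i) (A ^\<^sub>m i * B + B' * D) (0\<^sub>m m d) (D ^\<^sub>m Suc i)"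
    using assms B' by (intro cong_four_block_mat) auto
  finally show ?case using assms B' by (intro bexI[of _ "A ^\<^sub>m i * B + B' * D"]) auto
qed

lemma mat_trace_four_block_pow:
  fixes A :: "'a :: comm_ring_1 mat"
  assumes "A \<in> carrier_mat d d" "B \<in> carrier_mat d m" "D \<in> carrier_mat m m"
  shows "mat_trace (four_block_mat A B (0\<^sub>m m d) D ^\<^sub>m i) = mat_trace (A ^\<^sub>m i) + mat_trace (D ^\<^sub>m i)"
proof -
  from four_block_upper_pow[OF assms, of i] obtain B' where
    "four_block_mat A B (0\<^sub>m m d) D ^\<^sub>m i = four_block_mat (A ^\<^sub>m i) B' (0\<^sub>m m d) (D ^\<^sub>m i)"
    by auto
  then show ?thesis
    using assms by (simp add: mat_trace_four_block[of _ d _ m] del: index_mat_four_block)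
qed

lemma four_block_in_GL_iff:
  fixes A :: "'a :: field mat"
  assumes "A \<in> carrier_mat d d" "B \<in> carrier_mat d m" "D \<in> carrier_mat m m"
  shows "four_block_mat A B (0\<^sub>m m d) D \<in> GL (d + m) \<longleftrightarrow> A \<in> GL d \<and> D \<in> GL m"
  using assms by (auto simp: GL_iff_det det_four_block_mat_lower_left_zero)

lemma four_block_mat_inject:
  assumes "A \<in> carrier_mat d d" "B \<in> carrier_mat d m" "D \<in> carrier_mat m m"
    and "A' \<in> carrier_mat d d" "B' \<in> carrier_mat d m" "D' \<in> carrier_mat m m"
    and eq: "four_block_mat A B (0\<^sub>m m d) D = four_block_mat A' B' (0\<^sub>m m d) D'"
  shows "A = A' \<and> B = B' \<and> D = D'"
proof -
  have e: "four_block_mat A B (0\<^sub>m m d) D $$ (i,j) = four_block_mat A' B' (0\<^sub>m m d) D' $$ (i,j)" for i j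
    using eq by simp
  have "A $$ (i,j) = A' $$ (i,j)" if "i < d" "j < d" for i j
    using e[of i j] that assms(1-6) by auto
  moreover have "B $$ (i,j) = B' $$ (i,j)" if "i < d" "j < m" for i j
    using e[of i "d+j"] that assms(1-6) by auto
  moreover have "D $$ (i,j) = D' $$ (i,j)" if "i < m" "j < m" for i j
    using e[of "d+i" "d+j"] that assms(1-6) by auto
  ultimately show ?thesis using assms(1-6) by (intro conjI eq_matI) simp_all
qed

section \<open>Companion matrices\<close>

text \<open>The last column reads \<open>z d\<close>, ..., \<open>z 1\<close> from top to bottom, so
  for \<open>d\<close> at least 1 the characteristic polynomial is
  \<open>x^d - z 1 * x^(d-1) - ... - z d\<close>. With this indexing \<open>z i\<close> first enters
  the trace of the \<open>i\<close>-th power.\<close>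

definition companion :: "nat \<Rightarrow> (nat \<Rightarrow> 'a :: field) \<Rightarrow> 'a mat" where
  "companion d z = mat d d (\<lambda>(i, j). if Suc j = d then z (d - i) else if i = Suc j then 1 else 0)"

lemma companion_carrier [simp]: "companion d z \<in> carrier_mat d d"
  by (simp add: companion_def)

lemma companion_unit_vec:
  assumes "Suc j < d"
  shows "companion d z *\<^sub>v unit_vec d j = unit_vec d (Suc j)"
proof -
  have "companion d z *\<^sub>v unit_vec d j = col (companion d z) j"
    using assms by (intro mult_unit_vec[of _ d d]) auto
  also have "\<dots> = unit_vec d (Suc j)"
    using assms by (intro eq_vecI) (auto simp: companion_def)
  finally show ?thesis .
qed

lemma companion_pow_unit_vec:
  "l + s < d \<Longrightarrow> companion d z ^\<^sub>m s *\<^sub>v unit_vec d l = unit_vec d (l + s)"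
proof (induction s arbitrary: l)
  case 0
  then show ?case by (simp add: companion_def)
next
  case (Suc s)
  have "companion d z ^\<^sub>m Suc s *\<^sub>v unit_vec d l
      = companion d z ^\<^sub>m s *\<^sub>v (companion d z *\<^sub>v unit_vec d l)"
    by (simp add: assoc_mult_mat_vec[of _ d d _ d])
  then show ?case using Suc by (simp add: companion_unit_vec)
qed

lemma companion_mult_vec:
  assumes "v \<in> carrier_vec d" "i < d"
  shows "(companion d z *\<^sub>v v) $ i = z (d - i) * v $ (d - 1) + (if i = 0 then 0 else v $ (i - 1))"
proof -
  obtain e where d: "d = Suc e" using assms(2) by (cases d) auto
  have "(companion d z *\<^sub>v v) $ i = (\<Sum>j<d. companion d z $$ (i, j) * v $ j)"
    using assms by (simp add: scalar_prod_def companion_def atLeast0LessThan)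
  also have "\<dots> = (\<Sum>j<e. if i = Suc j then v $ j else 0) + z (d - i) * v $ e"
    using assms(2) unfolding d companion_def
    by (simp del: diff_Suc_Suc) (intro sum.cong, auto)
  also have "(\<Sum>j<e. if i = Suc j then v $ j else 0) = (if i = 0 then 0 else v $ (i - 1))"
    using assms(2) by (cases i) (simp_all add: d)
  finally show ?thesis by (simp add: d)
qed

text \<open>Up to sign \<open>z d\<close> is the determinant. The argument uses the kernel instead:
  row 0 of \<open>C v = 0\<close> is \<open>z d * v $ (d - 1) = 0\<close>, and every later row
  expresses \<open>v $ (i - 1)\<close> through \<open>v $ (d - 1)\<close>.\<close>

lemma companion_in_GL_iff:
  assumes "1 \<le> d"
  shows "companion d z \<in> GL d \<longleftrightarrow> z d \<noteq> 0"
proof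
  assume C: "companion d z \<in> GL d"
  show "z d \<noteq> 0"
  proof
    assume z: "z d = 0"
    \<comment> \<open>The kernel vector with last coordinate 1; its other coordinates are forced by
      rows \<open>1\<close> to \<open>d - 1\<close>, and row 0 holds because
      \<open>z d = 0\<close>.\<close>
    define v where "v = vec d (\<lambda>i. if i = d - 1 then 1 else - z (d - Suc i))"
    have v: "v \<in> carrier_vec d" by (simp add: v_def)
    have "companion d z *\<^sub>v v = 0\<^sub>v d"
    proof (intro eq_vecI)
      fix i assume "i < dim_vec (0\<^sub>v d)"
      then have i: "i < d" by simp
      have "(companion d z *\<^sub>v v) $ i = 0"
        using i z unfolding companion_mult_vec[OF v i] by (cases i) (auto simp: v_def)
      then show "(companion d z *\<^sub>v v) $ i = 0\<^sub>v d $ i" using i by simp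
    qed (simp add: companion_def)
    then have "v = 0\<^sub>v d" using C v by (auto simp: GL_iff_kernel)
    moreover have "v $ (d - 1) = 1" using assms by (simp add: v_def)
    ultimately show False using assms by simp
  qed
next
  assume z: "z d \<noteq> 0"
  have "v = 0\<^sub>v d" if v: "v \<in> carrier_vec d" and 0: "companion d z *\<^sub>v v = 0\<^sub>v d" for v
  proof -
    have e: "z (d - i) * v $ (d - 1) + (if i = 0 then 0 else v $ (i - 1)) = 0" if "i < d" for i
      using companion_mult_vec[OF v that, of z] 0 that by simp
    have last: "v $ (d - 1) = 0" using e[of 0] z assms by simp
    have "v $ i = 0" if "i < d" for i
    proof (cases "Suc i < d")
      case True
      then show ?thesis using e[of "Suc i"] last by simp
    next
      case False
      then have "i = d - 1" using that by simp
      then show ?thesis using last by simp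
    qed
    then show ?thesis using v by (intro eq_vecI) auto
  qed
  then show "companion d z \<in> GL d" by (simp add: GL_iff_kernel)
qed

lemma pow_mat_commute:
  fixes A :: "'a :: semiring_1 mat"
  assumes "A \<in> carrier_mat n n"
  shows "A * A ^\<^sub>m r = A ^\<^sub>m r * A"
proof (induction r)
  case (Suc r)
  have "A * A ^\<^sub>m Suc r = A * A ^\<^sub>m r * A"
    using assms by (simp add: assoc_mult_mat[of _ n n _ n _ n])
  then show ?case using Suc by simp
qed (use assms in simp)

text \<open>Only the last columns of the two companion matrices differ, and below row \<open>d - i\<close> they agree;
  since the matrices shift the unit vectors, each term of the telescoping sum picks out the
  single entry in row \<open>d - i\<close>. This replaces Newton's identities.\<close>

lemma mat_trace_companion_pow_diff:
  fixes z z' :: "nat \<Rightarrow> 'a :: field"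
  assumes i: "1 \<le> i" "i \<le> d" and agree: "\<And>j. 1 \<le> j \<Longrightarrow> j < i \<Longrightarrow> z j = z' j"
  shows "mat_trace (companion d z ^\<^sub>m i) - mat_trace (companion d z' ^\<^sub>m i) = of_nat i * (z i - z' i)"
proof -
  let ?C = "companion d z" and ?C' = "companion d z'"
  have step: "mat_trace (?C' ^\<^sub>m r * ?C ^\<^sub>m Suc s) - mat_trace (?C' ^\<^sub>m Suc r * ?C ^\<^sub>m s) = z i - z' i"
    if "Suc (r + s) = i" for r s
  proof -
    define X where "X = ?C' ^\<^sub>m r * ?C ^\<^sub>m s"
    have X: "X \<in> carrier_mat d d"
      unfolding X_def by (rule mult_carrier_mat[of _ d d]) (simp_all add: pow_carrier_mat)
    have tr: "mat_trace (X * companion d y) = (\<Sum>a<d. \<Sum>l<d. X $$ (a, l) * companion d y $$ (l, a))" for y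
      using X by (simp add: mat_trace_def scalar_prod_def atLeast0LessThan companion_def)
    \<comment> \<open>Columns to the right of \<open>d - i\<close> need no formula: there
      \<open>d - l < i\<close>, so \<open>z (d - l) - z' (d - l)\<close> vanishes by
      \<open>agree\<close>.\<close>
    have entry: "X $$ (d - 1, l) = (if l = d - i then 1 else 0)" if l: "l \<le> d - i" for l
    proof -
      have "X *\<^sub>v unit_vec d l = ?C' ^\<^sub>m r *\<^sub>v (?C ^\<^sub>m s *\<^sub>v unit_vec d l)"
        unfolding X_def by (rule assoc_mult_mat_vec[of _ d d _ d]) simp_all
      also have "\<dots> = unit_vec d (l + s + r)"
        using l i \<open>Suc (r + s) = i\<close> by (simp add: companion_pow_unit_vec)
      finally have "col X l = unit_vec d (l + s + r)"
        using mult_unit_vec[OF X, of l] l i by simp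
      then have "X $$ (d - 1, l) = unit_vec d (l + s + r) $ (d - 1)"
        using X l i index_col[of "d - 1" X l] by simp
      moreover have "d - 1 = l + s + r \<longleftrightarrow> l = d - i" using l i \<open>Suc (r + s) = i\<close> by linarith
      moreover have "unit_vec d (l + s + r) $ (d - 1) = (if d - 1 = l + s + r then 1 else 0 :: 'a)"
        using i by (simp add: unit_vec_def)
      ultimately show ?thesis by simp
    qed
    have "mat_trace (?C' ^\<^sub>m r * ?C ^\<^sub>m Suc s) = mat_trace (X * ?C)"
      by (simp add: X_def assoc_mult_mat[of _ d d _ d _ d])
    moreover have "mat_trace (?C' ^\<^sub>m Suc r * ?C ^\<^sub>m s) = mat_trace (X * ?C')"
    proof -
      have "?C' ^\<^sub>m Suc r * ?C ^\<^sub>m s = ?C' * X"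
        by (simp add: X_def assoc_mult_mat[of _ d d _ d _ d] flip: pow_mat_commute[of _ d])
      then show ?thesis using X by (simp add: mat_trace_comm[of _ d d])
    qed
    ultimately have "mat_trace (?C' ^\<^sub>m r * ?C ^\<^sub>m Suc s) - mat_trace (?C' ^\<^sub>m Suc r * ?C ^\<^sub>m s)
        = (\<Sum>a<d. \<Sum>l<d. X $$ (a, l) * (?C $$ (l, a) - ?C' $$ (l, a)))"
      by (simp add: tr right_diff_distrib flip: sum_subtractf)
    also have "\<dots> = (\<Sum>a<d. if a = d - 1 then \<Sum>l<d. X $$ (d - 1, l) * (z (d - l) - z' (d - l)) else 0)"
    proof (intro sum.cong refl)
      fix a assume "a \<in> {..<d}"
      then show "(\<Sum>l<d. X $$ (a, l) * (?C $$ (l, a) - ?C' $$ (l, a)))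
        = (if a = d - 1 then \<Sum>l<d. X $$ (d - 1, l) * (z (d - l) - z' (d - l)) else 0)"
        by (auto simp: companion_def intro!: sum.neutral)
    qed
    also have "\<dots> = (\<Sum>l<d. X $$ (d - 1, l) * (z (d - l) - z' (d - l)))"
      using i by simp
    also have "\<dots> = (\<Sum>l<d. if l = d - i then z i - z' i else 0)"
    proof (intro sum.cong refl)
      fix l assume "l \<in> {..<d}"
      then show "X $$ (d - 1, l) * (z (d - l) - z' (d - l)) = (if l = d - i then z i - z' i else 0)"
        using entry[of l] agree[of "d - l"] i by (cases "l \<le> d - i") auto
    qed
    also have "\<dots> = z i - z' i" using i by simp
    finally show ?thesis .
  qed
  \<comment> \<open>Interpolates between the power of \<open>companion d z'\<close> at
    \<open>s = 0\<close> and that of \<open>companion d z\<close> at \<open>s = i\<close>; each of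
    the \<open>i\<close> increments equals \<open>z i - z' i\<close>.\<close>
  define t where "t s = mat_trace (?C' ^\<^sub>m (i - s) * ?C ^\<^sub>m s)" for s
  have t: "t (Suc s) - t s = z i - z' i" if "s < i" for s
    using step[of "i - Suc s" s] that by (simp add: t_def Suc_diff_Suc del: pow_mat.simps)
  have "t s - t 0 = of_nat s * (z i - z' i)" if "s \<le> i" for s
    using that
  proof (induction s)
    case (Suc s)
    have "t (Suc s) - t 0 = (t (Suc s) - t s) + (t s - t 0)" by simp
    also have "\<dots> = of_nat (Suc s) * (z i - z' i)"
      using Suc by (simp add: t algebra_simps)
    finally show ?case .
  qed simp
  from this[of i] show ?thesis by (simp add: t_def companion_def)
qed

section \<open>Counting with triangular constraints\<close>

text \<open>Replacing \<open>z i\<close> by \<open>g i z\<close> for all \<open>i\<close> in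
  \<open>J\<close> is injective, since the coordinates can be recovered in increasing order. On a
  finite set it is therefore a permutation, and the counted set is the preimage of a box.\<close>

lemma card_triangular:
  fixes g :: "nat \<Rightarrow> (nat \<Rightarrow> 'a :: finite) \<Rightarrow> 'a"
  assumes J: "J \<subseteq> {1..d}"
    and tri: "\<And>i z z'. i \<in> J \<Longrightarrow> (\<And>j. 1 \<le> j \<Longrightarrow> j < i \<Longrightarrow> z j = z' j) \<Longrightarrow> g i z = g i z' \<Longrightarrow> z i = z' i"
  shows "card {z \<in> PiE {1..d} (\<lambda>_. UNIV). (\<forall>i\<in>J. g i z = b i) \<and> (\<forall>i\<in>{1..d} - J. z i \<in> E i)}
    = (\<Prod>i\<in>{1..d} - J. card (E i))" (is "card ?S = _")
proof -
  define U where "U = PiE {1..d} (\<lambda>_. UNIV :: 'a set)"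
  define W where "W = PiE {1..d} (\<lambda>i. if i \<in> J then {b i} else E i)"
  define \<phi> where "\<phi> z = restrict (\<lambda>i. if i \<in> J then g i z else z i) {1..d}" for z
  have "finite U" unfolding U_def by (rule finite_PiE) simp_all
  have inj: "inj_on \<phi> U"
  proof (rule inj_onI)
    fix z z' assume zz: "z \<in> U" "z' \<in> U" and eq: "\<phi> z = \<phi> z'"
    have *: "1 \<le> i \<longrightarrow> i \<le> d \<longrightarrow> z i = z' i" for i
    proof (induction i rule: less_induct)
      case (less i)
      show ?case
      proof (intro impI)
        assume i: "1 \<le> i" "i \<le> d"
        have agree: "z j = z' j" if "1 \<le> j" "j < i" for j
          using less[of j] that i by simp
        have "(if i \<in> J then g i z else z i) = (if i \<in> J then g i z' else z' i)"
          using fun_cong[OF eq, of i] i by (simp only: \<phi>_def restrict_apply) simp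
        then show "z i = z' i"
          using tri[OF _ agree] by (cases "i \<in> J") simp_all
      qed
    qed
    show "z = z'" using zz * unfolding U_def by (intro PiE_ext) auto
  qed
  have "\<phi> ` U \<subseteq> U" unfolding U_def \<phi>_def by (intro image_subsetI) simp
  then have surj: "\<phi> ` U = U" using endo_inj_surj[OF \<open>finite U\<close>] inj by blast
  have W: "\<phi> z \<in> W \<longleftrightarrow> (\<forall>i\<in>J. g i z = b i) \<and> (\<forall>i\<in>{1..d} - J. z i \<in> E i)" for z
  proof -
    have "\<phi> z \<in> W \<longleftrightarrow> (\<forall>i\<in>{1..d}. (if i \<in> J then g i z else z i) \<in> (if i \<in> J then {b i} else E i))"
      unfolding \<phi>_def W_def by (simp only: restrict_PiE_iff)
    also have "\<dots> \<longleftrightarrow> (\<forall>i\<in>J \<union> ({1..d} - J). (if i \<in> J then g i z else z i) \<in> (if i \<in> J then {b i} else E i))"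
      using J by (simp only: Un_Diff_cancel Un_absorb1)
    also have "\<dots> \<longleftrightarrow> (\<forall>i\<in>J. g i z = b i) \<and> (\<forall>i\<in>{1..d} - J. z i \<in> E i)"
      unfolding ball_Un by (intro arg_cong2[where f = "(\<and>)"] ball_cong refl) simp_all
    finally show ?thesis .
  qed
  have "W \<subseteq> U" unfolding W_def U_def by (intro PiE_mono) simp
  have "?S = {z \<in> U. \<phi> z \<in> W}" by (simp only: W U_def)
  moreover have "\<phi> ` {z \<in> U. \<phi> z \<in> W} = W" 
  proof (intro equalityI subsetI)
    fix w assume w: "w \<in> W"
    then have "w \<in> \<phi> ` U" using surj \<open>W \<subseteq> U\<close> by (simp only: subsetD)
    then obtain z where "z \<in> U" "w = \<phi> z" by (rule imageE)
    then show "w \<in> \<phi> ` {z \<in> U. \<phi> z \<in> W}" using w by simp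
  qed (erule imageE, simp)
  ultimately have "\<phi> ` ?S = W" by (simp only:)
  moreover have "inj_on \<phi> ?S"
    by (rule inj_on_subset[OF inj]) (simp add: U_def subset_iff)
  ultimately have "card ?S = card W" using card_image[of \<phi> ?S] by (simp only:)
  also have "\<dots> = (\<Prod>i\<in>{1..d}. if i \<in> J then 1 else card (E i))"
    unfolding W_def card_PiE[OF finite_atLeastAtMost] by (intro prod.cong refl) simp
  also have "\<dots> = (\<Prod>i\<in>{1..d} - J. card (E i))"
    by (intro prod.mono_neutral_cong_right) auto
  finally show ?thesis .
qed

text \<open>For \<open>1 \<le> d\<close>, \<open>z d \<noteq> 0\<close> is invertibility of the
  companion matrix. Using \<open>PiE\<close> makes the coefficient tuple unique, so that counting
  tuples counts matrices.\<close>

definition comp_solutions :: "nat \<Rightarrow> nat set \<Rightarrow> (nat \<Rightarrow> 'a :: field) \<Rightarrow> (nat \<Rightarrow> 'a) set" where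
  "comp_solutions d J b = {z \<in> PiE {1..d} (\<lambda>_. UNIV). z d \<noteq> 0
     \<and> (\<forall>i\<in>J. mat_trace (companion d z ^\<^sub>m i) = b i)}"

text \<open>The place where \<open>p\<close> not dividing \<open>i\<close> enters: the two traces
  differ by \<open>of_nat i * (z i - z' i)\<close>, and the factor \<open>of_nat i\<close> can be
  cancelled. This is the triangularity needed for \<open>card_triangular\<close>.\<close>

lemma companion_trace_triangular:
  fixes z z' :: "nat \<Rightarrow> 'a :: field"
  assumes "i \<in> {1..d}" "of_nat i \<noteq> (0 :: 'a)"
    and "\<And>j. 1 \<le> j \<Longrightarrow> j < i \<Longrightarrow> z j = z' j"
    and "mat_trace (companion d z ^\<^sub>m i) = mat_trace (companion d z' ^\<^sub>m i)"
  shows "z i = z' i"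
  using mat_trace_companion_pow_diff[of i d z z'] assms by auto

text \<open>As \<open>d\<close> lies outside \<open>J\<close>, the coordinate \<open>z d\<close> is
  free apart from being nonzero, which gives the factor \<open>CARD('a) - 1\<close>. The result is
  independent of \<open>b\<close>; multiplying by \<open>CARD('a) ^ card J\<close> avoids a
  subtraction in the exponent.\<close>

lemma card_comp_solutions:
  fixes b :: "nat \<Rightarrow> 'a :: {field, finite}"
  assumes J: "J \<subseteq> {1..<d}" "\<And>i. i \<in> J \<Longrightarrow> of_nat i \<noteq> (0 :: 'a)" and d: "1 \<le> d"
  shows "card (comp_solutions d J b) * CARD('a) ^ card J = (CARD('a) - 1) * CARD('a) ^ (d - 1)"
proof -
  let ?E = "\<lambda>i. if i = d then - {0 :: 'a} else UNIV"
  have fin: "finite J" using J(1) finite_subset by blast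
  have "comp_solutions d J b = {z \<in> PiE {1..d} (\<lambda>_. UNIV).
      (\<forall>i\<in>J. mat_trace (companion d z ^\<^sub>m i) = b i) \<and> (\<forall>i\<in>{1..d} - J. z i \<in> ?E i)}"
    using J(1) d by (auto simp: comp_solutions_def)
  also have "card \<dots> = (\<Prod>i\<in>{1..d} - J. card (?E i))"
  proof (rule card_triangular)
    show "J \<subseteq> {1..d}" using J(1) by auto
    fix i and z z' :: "nat \<Rightarrow> 'a"
    assume i: "i \<in> J" and a: "\<And>j. 1 \<le> j \<Longrightarrow> j < i \<Longrightarrow> z j = z' j"
      and tr: "mat_trace (companion d z ^\<^sub>m i) = mat_trace (companion d z' ^\<^sub>m i)"
    have "i \<in> {1..d}" using i J(1) by auto
    from companion_trace_triangular[OF this J(2)[OF i] a tr] show "z i = z' i" .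
  qed
  also have "{1..d} - J = insert d ({1..<d} - J)" using J(1) d by auto
  also have "(\<Prod>i\<in>insert d ({1..<d} - J). card (?E i)) = card (- {0 :: 'a}) * (\<Prod>i\<in>{1..<d} - J. card (?E i))"
    by (subst prod.insert) auto
  also have "(\<Prod>i\<in>{1..<d} - J. card (?E i)) = (\<Prod>i\<in>{1..<d} - J. CARD('a))"
    by (intro prod.cong) auto
  also have "\<dots> = CARD('a) ^ (d - 1 - card J)"
    using J(1) fin by (simp add: card_Diff_subset)
  also have "card (- {0 :: 'a}) = CARD('a) - 1" by (simp add: Compl_eq_Diff_UNIV card_Diff_singleton)
  finally have "card (comp_solutions d J b) = (CARD('a) - 1) * CARD('a) ^ (d - 1 - card J)" .
  moreover have "card J \<le> d - 1" using card_mono[OF _ J(1)] by simp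
  then have "d - 1 - card J + card J = d - 1" by simp
  ultimately show ?thesis by (metis mult.assoc power_add)
qed

text \<open>When \<open>d\<close> lies in \<open>J\<close>, the condition at \<open>d\<close> may
  interact with \<open>z d \<noteq> 0\<close>, so only an upper bound is taken: the nonvanishing and
  all conditions with index above \<open>d\<close> are dropped, and the rest is counted
  exactly.\<close>

lemma card_comp_solutions_le:
  fixes b :: "nat \<Rightarrow> 'a :: {field, finite}"
  assumes J: "\<And>i. i \<in> J \<Longrightarrow> of_nat i \<noteq> (0 :: 'a)"
  shows "card (comp_solutions d J b) \<le> CARD('a) ^ (d - card (J \<inter> {1..d}))"
proof -
  let ?S = "{z \<in> PiE {1..d} (\<lambda>_. UNIV). (\<forall>i\<in>J \<inter> {1..d}. mat_trace (companion d z ^\<^sub>m i) = b i)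
      \<and> (\<forall>i\<in>{1..d} - (J \<inter> {1..d}). z i \<in> (UNIV :: 'a set))}"
  have "comp_solutions d J b \<subseteq> ?S" by (auto simp: comp_solutions_def)
  moreover have "finite ?S"
  proof (rule finite_subset)
    show "?S \<subseteq> PiE {1..d} (\<lambda>_. UNIV)" by (rule subsetI) simp
    show "finite (PiE {1..d} (\<lambda>_. UNIV :: 'a set))" by (rule finite_PiE) simp_all
  qed
  ultimately have "card (comp_solutions d J b) \<le> card ?S" by (rule card_mono[rotated])
  also have "card ?S = (\<Prod>i\<in>{1..d} - (J \<inter> {1..d}). CARD('a))"
  proof (rule card_triangular)
    show "J \<inter> {1..d} \<subseteq> {1..d}" by simp
    fix i and z z' :: "nat \<Rightarrow> 'a"
    assume i: "i \<in> J \<inter> {1..d}" and a: "\<And>j. 1 \<le> j \<Longrightarrow> j < i \<Longrightarrow> z j = z' j"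
      and tr: "mat_trace (companion d z ^\<^sub>m i) = mat_trace (companion d z' ^\<^sub>m i)"
    have "i \<in> {1..d}" "i \<in> J" using i by auto
    from companion_trace_triangular[OF this(1) J[OF this(2)] a tr] show "z i = z' i" .
  qed
  also have "\<dots> = CARD('a) ^ (d - card (J \<inter> {1..d}))"
    by (simp add: card_Diff_subset)
  finally show ?thesis .
qed

lemma card_not_dvd:
  fixes p :: nat
  assumes "p > 0"
  shows "card {i \<in> {1..k}. \<not> p dvd i} = k - k div p"
proof (induction k)
  case (Suc k)
  have "{i \<in> {1..Suc k}. \<not> p dvd i} = (if p dvd Suc k then {} else {Suc k}) \<union> {i \<in> {1..k}. \<not> p dvd i}"
    by (auto simp: le_Suc_eq)
  moreover have "k div p \<le> k" by simp
  ultimately show ?case using Suc assms by (auto simp: div_Suc Suc_diff_le mod_eq_0_iff_dvd)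
qed simp

section \<open>Cyclic block form\<close>

text \<open>For \<open>d \<le> n\<close> this is the span of the first \<open>d\<close> unit
  vectors, described by vanishing coordinates.\<close>

definition low_span :: "nat \<Rightarrow> nat \<Rightarrow> 'a :: field vec set" where
  "low_span n d = {x \<in> carrier_vec n. \<forall>i<n. d \<le> i \<longrightarrow> x $ i = 0}"

text \<open>\<open>cyclic_shape n d N\<close> says that \<open>N\<close> has block form
  \<open>[[companion, *], [0, *]]\<close> with upper left block of size \<open>d\<close>.\<close>

definition cyclic_shape :: "nat \<Rightarrow> nat \<Rightarrow> 'a :: field mat \<Rightarrow> bool" where
  "cyclic_shape n d N \<longleftrightarrow> (\<forall>j. Suc j < d \<longrightarrow> N *\<^sub>v unit_vec n j = unit_vec n (Suc j))
     \<and> N *\<^sub>v unit_vec n (d - 1) \<in> low_span n d"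

text \<open>The pointwise stabiliser of the first \<open>d\<close> unit vectors. It measures the
  freedom in choosing an adapted basis for a given matrix and starting vector.\<close>

definition GL_fix :: "nat \<Rightarrow> nat \<Rightarrow> 'a :: field mat set" where
  "GL_fix n d = {R \<in> GL n. \<forall>j<d. R *\<^sub>v unit_vec n j = unit_vec n j}"

lemma GL_fixD:
  assumes "R \<in> GL_fix n d"
  shows "R \<in> GL n" "\<And>j. j < d \<Longrightarrow> R *\<^sub>v unit_vec n j = unit_vec n j"
  using assms by (auto simp: GL_fix_def)

lemma fix_low_span:
  fixes R :: "'a :: field mat"
  assumes R: "R \<in> carrier_mat n n" and d: "d \<le> n"
    and fixed: "\<And>j. j < d \<Longrightarrow> R *\<^sub>v unit_vec n j = unit_vec n j"
    and x: "x \<in> low_span n d"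
  shows "R *\<^sub>v x = x"
proof (rule eq_vecI)
  have xc: "x \<in> carrier_vec n" using x by (simp add: low_span_def)
  show "dim_vec (R *\<^sub>v x) = dim_vec x" using R xc by simp
  fix i assume "i < dim_vec x"
  then have i: "i < n" using xc by simp
  have entry: "R $$ (i, j) = (if i = j then 1 else 0)" if "j < d" for j
  proof -
    have "col R j = unit_vec n j" using fixed[OF that] mult_unit_vec[OF R, of j] that d by simp
    then have "col R j $ i = unit_vec n j $ i" by simp
    then show ?thesis using R i that d by simp
  qed
  have "(R *\<^sub>v x) $ i = (\<Sum>j<n. R $$ (i, j) * x $ j)"
    using R xc i by (simp add: scalar_prod_def atLeast0LessThan)
  also have "\<dots> = (\<Sum>j<n. if i = j then x $ j else 0)"
  proof (intro sum.cong refl)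
    fix j assume "j \<in> {..<n}"
    then show "R $$ (i, j) * x $ j = (if i = j then x $ j else 0)"
      using entry[of j] x by (cases "j < d") (simp_all add: low_span_def)
  qed
  also have "\<dots> = x $ i" using i by simp
  finally show "(R *\<^sub>v x) $ i = x $ i" .
qed

section \<open>Intertwining matrices and uniqueness of the cyclic dimension\<close>

lemma gl_inv_fixes:
  assumes "R \<in> GL n" "x \<in> carrier_vec n" "R *\<^sub>v x = x"
  shows "gl_inv R *\<^sub>v x = x"
  using gl_inv_mult_vec(1)[OF assms(1,2)] assms(3) by simp

lemma conj_mult_vec:
  assumes "P \<in> GL n" "M \<in> carrier_mat n n" "x \<in> carrier_vec n"
  shows "(gl_inv P * M * P) *\<^sub>v x = gl_inv P *\<^sub>v (M *\<^sub>v (P *\<^sub>v x))"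
  using assms GL_carrier[OF assms(1)] gl_inv_carrier[OF assms(1)]
  by (simp add: assoc_mult_mat_vec[of _ n n _ n])

text \<open>An intertwiner \<open>R\<close> fixing the first unit vector carries the iterates of
  that vector under \<open>N\<close> to those under \<open>N0\<close>; below both sizes the
  \<open>j\<close>-th iterate is the \<open>j\<close>-th unit vector on either side.\<close>

lemma cyclic_shape_fixes:
  fixes R :: "'a :: field mat"
  assumes R: "R \<in> carrier_mat n n" and N0: "N0 \<in> carrier_mat n n" and N: "N \<in> carrier_mat n n"
    and comm: "N0 * R = R * N" and e0: "R *\<^sub>v unit_vec n 0 = unit_vec n 0"
    and d0: "d0 \<le> n" "cyclic_shape n d0 N0" and d: "d \<le> n" "cyclic_shape n d N"
  shows "j < d \<Longrightarrow> j < d0 \<Longrightarrow> R *\<^sub>v unit_vec n j = unit_vec n j"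
proof (induction j)
  case (Suc j)
  have "R *\<^sub>v unit_vec n (Suc j) = R *\<^sub>v (N *\<^sub>v unit_vec n j)"
    using d(2) Suc.prems by (simp add: cyclic_shape_def)
  also have "\<dots> = (N0 * R) *\<^sub>v unit_vec n j"
    using R N unfolding comm by simp
  also have "\<dots> = N0 *\<^sub>v (R *\<^sub>v unit_vec n j)" using R N0 by simp
  also have "\<dots> = unit_vec n (Suc j)"
    using Suc d0(2) by (simp add: cyclic_shape_def)
  finally show ?case .
qed (rule e0)

text \<open>If \<open>d0 < d\<close>, then \<open>R\<close> sends unit vector \<open>d0\<close>, the
  next iterate under \<open>N\<close>, to the next iterate \<open>x\<close> under \<open>N0\<close>.
  But \<open>x\<close> lies in \<open>low_span n d0\<close>, which \<open>R\<close> fixes pointwise,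
  so injectivity of \<open>R\<close> would put unit vector \<open>d0\<close> into that span.\<close>

lemma cyclic_shape_le:
  fixes R :: "'a :: field mat"
  assumes R: "R \<in> GL n" and N0: "N0 \<in> carrier_mat n n" and N: "N \<in> carrier_mat n n"
    and comm: "N0 * R = R * N" and e0: "R *\<^sub>v unit_vec n 0 = unit_vec n 0"
    and d0: "1 \<le> d0" "d0 \<le> n" "cyclic_shape n d0 N0" and d: "d \<le> n" "cyclic_shape n d N"
  shows "d \<le> d0"
proof (rule ccontr)
  assume "\<not> d \<le> d0"
  then have lt: "d0 < d" by simp
  have Rc: "R \<in> carrier_mat n n" using R by (rule GL_carrier)
  have fixed: "R *\<^sub>v unit_vec n j = unit_vec n j" if "j < d0" for j
    using cyclic_shape_fixes[OF Rc N0 N comm e0 d0(2,3) d] that lt by simp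
  define x where "x = N0 *\<^sub>v unit_vec n (d0 - 1)"
  have x: "x \<in> low_span n d0" using d0(3) by (simp add: cyclic_shape_def x_def)
  then have xc: "x \<in> carrier_vec n" by (simp add: low_span_def)
  have "R *\<^sub>v unit_vec n d0 = R *\<^sub>v (N *\<^sub>v unit_vec n (d0 - 1))"
    using d(2) lt d0(1) by (simp add: cyclic_shape_def)
  also have "\<dots> = (N0 * R) *\<^sub>v unit_vec n (d0 - 1)"
    using Rc N unfolding comm by simp
  also have "\<dots> = N0 *\<^sub>v (R *\<^sub>v unit_vec n (d0 - 1))" using Rc N0 by simp
  also have "\<dots> = x" using fixed[of "d0 - 1"] d0(1) by (simp add: x_def)
  also have "\<dots> = R *\<^sub>v x" using fix_low_span[OF Rc d0(2) fixed x] by simp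
  finally have "gl_inv R *\<^sub>v (R *\<^sub>v unit_vec n d0) = gl_inv R *\<^sub>v (R *\<^sub>v x)" by simp
  then have "unit_vec n d0 = x" using R xc by (simp add: gl_inv_mult_vec)
  then have "unit_vec n d0 $ d0 = (0 :: 'a)" using x lt d(1) by (simp add: low_span_def)
  then show False using lt d(1) by simp
qed

text \<open>The exchange step of basis extension: a vector outside the span of the first
  \<open>d\<close> unit vectors can serve as the next basis vector.\<close>

lemma exists_GL_fix_extend:
  fixes x :: "'a :: field vec"
  assumes x: "x \<in> carrier_vec n" "x \<notin> low_span n d"
  shows "\<exists>R\<in>GL_fix n d. d < n \<and> R *\<^sub>v unit_vec n d = x"
proof -
  obtain j where j: "d \<le> j" "j < n" "x $ j \<noteq> 0" using x by (auto simp: low_span_def)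
  \<comment> \<open>The identity with column \<open>d\<close> replaced by \<open>x\<close> and, if
    \<open>j\<close> differs from \<open>d\<close>, column \<open>j\<close> replaced by unit vector
    \<open>d\<close>; this stays invertible because \<open>x $ j\<close> is nonzero.\<close>
  define R where "R = mat n n (\<lambda>(a, b). if b = d then x $ a
      else if b = j then (if a = d then 1 else 0) else if a = b then 1 else 0)"
  have Rc: "R \<in> carrier_mat n n" by (simp add: R_def)
  have "y = 0\<^sub>v n" if y: "y \<in> carrier_vec n" and 0: "R *\<^sub>v y = 0\<^sub>v n" for y
  proof -
    have row: "x $ a * y $ d + (if j \<noteq> d \<and> a = d then y $ j else 0)
        + (if a \<noteq> d \<and> a \<noteq> j then y $ a else 0) = 0" if a: "a < n" for a
    proof -
      have "(R *\<^sub>v y) $ a = (\<Sum>b<n. R $$ (a, b) * y $ b)"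
        using Rc y a by (simp add: scalar_prod_def atLeast0LessThan)
      also have "\<dots> = (\<Sum>b<n. (if b = d then x $ a * y $ d else 0)
          + (if b = j then if j \<noteq> d \<and> a = d then y $ j else 0 else 0)
          + (if b = a then if a \<noteq> d \<and> a \<noteq> j then y $ a else 0 else 0))"
        using a by (intro sum.cong refl) (simp add: R_def)
      also have "\<dots> = x $ a * y $ d + (if j \<noteq> d \<and> a = d then y $ j else 0)
          + (if a \<noteq> d \<and> a \<noteq> j then y $ a else 0)"
        using j a by (simp add: sum.distrib)
      finally show ?thesis using 0 a by simp
    qed
    \<comment> \<open>Row \<open>j\<close> reads \<open>x $ j * y $ d = 0\<close>; after that row
      \<open>d\<close> yields \<open>y $ j = 0\<close>, and each remaining row its own
      coordinate.\<close>
    have yd: "y $ d = 0" using row[OF j(2)] j(3) by (cases "j = d") simp_all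
    have yj: "y $ j = 0" using row[of d] yd j by (cases "j = d") simp_all
    have "y $ a = 0" if "a < n" for a
      using row[OF that] yd yj by (cases "a = d \<or> a = j") auto
    then show ?thesis using y by (intro eq_vecI) simp_all
  qed
  then have R: "R \<in> GL n" using Rc by (simp add: GL_iff_kernel)
  have "R *\<^sub>v unit_vec n b = unit_vec n b" if "b < d" for b
  proof -
    have "R *\<^sub>v unit_vec n b = col R b" using that j by (intro mult_unit_vec[OF Rc]) simp
    also have "\<dots> = unit_vec n b" using that j by (intro eq_vecI) (simp_all add: R_def unit_vec_def)
    finally show ?thesis .
  qed
  moreover have "R *\<^sub>v unit_vec n d = x"
  proof -
    have "R *\<^sub>v unit_vec n d = col R d" using j by (intro mult_unit_vec[OF Rc]) simp
    also have "\<dots> = x" using j x by (intro eq_vecI) (simp_all add: R_def)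
    finally show ?thesis .
  qed
  ultimately show ?thesis using R j by (intro bexI[of _ R]) (simp_all add: GL_fix_def)
qed

text \<open>Take the largest \<open>d\<close> for which the first \<open>d\<close> iterates of
  \<open>v\<close> under \<open>M\<close> begin a basis. If the next iterate were outside their
  span, the exchange step would give a basis for \<open>Suc d\<close>.\<close>

lemma exists_cyclic_basis:
  fixes M :: "'a :: field mat"
  assumes M: "M \<in> carrier_mat n n" and v: "v \<in> carrier_vec n" "v \<noteq> 0\<^sub>v n"
  shows "\<exists>d\<in>{1..n}. \<exists>P\<in>GL n. P *\<^sub>v unit_vec n 0 = v \<and> cyclic_shape n d (gl_inv P * M * P)"
proof -
  define good where "good d P \<longleftrightarrow> P \<in> GL n \<and> P *\<^sub>v unit_vec n 0 = v
     \<and> (\<forall>j. Suc j < d \<longrightarrow> M *\<^sub>v (P *\<^sub>v unit_vec n j) = P *\<^sub>v unit_vec n (Suc j))" for d P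
  define Ds where "Ds = {d \<in> {1..n}. \<exists>P. good d P}"
  \<comment> \<open>\<open>low_span n 0\<close> is the zero space, so the exchange step with
    \<open>d = 0\<close> gives a basis starting with \<open>v\<close>.\<close>
  have "v \<notin> low_span n 0"
  proof
    assume "v \<in> low_span n 0"
    then have "v = 0\<^sub>v n" by (intro eq_vecI) (simp_all add: low_span_def)
    then show False using v by simp
  qed
  then obtain R where R: "R \<in> GL_fix n 0" "0 < n" "R *\<^sub>v unit_vec n 0 = v"
    using exists_GL_fix_extend[of v n 0] v by auto
  then have "good 1 R" by (simp add: good_def GL_fix_def)
  then have "1 \<in> Ds" using R(2) by (auto simp: Ds_def)
  have fin: "finite Ds" by (simp add: Ds_def)
  define d where "d = Max Ds"
  have "d \<in> Ds" unfolding d_def using fin \<open>1 \<in> Ds\<close> by (intro Max_in) auto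
  then obtain P where d: "1 \<le> d" "d \<le> n" and P: "good d P" by (auto simp: Ds_def)
  have PG: "P \<in> GL n" using P by (simp add: good_def)
  note Pc = GL_carrier[OF PG] gl_inv_carrier[OF PG]
  define y where "y = gl_inv P *\<^sub>v (M *\<^sub>v (P *\<^sub>v unit_vec n (d - 1)))"
  have yc: "y \<in> carrier_vec n" using Pc M by (simp add: y_def)
  have Py: "P *\<^sub>v y = M *\<^sub>v (P *\<^sub>v unit_vec n (d - 1))"
    unfolding y_def
    by (intro gl_inv_mult_vec(2)[OF PG] mult_mat_vec_carrier[OF M] mult_mat_vec_carrier[OF Pc(1)]) simp
  have "y \<in> low_span n d"
  proof (rule ccontr)
    assume "y \<notin> low_span n d"
    then obtain R where R: "R \<in> GL_fix n d" "d < n" "R *\<^sub>v unit_vec n d = y"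
      using exists_GL_fix_extend[OF yc] by auto
    note RG = GL_fixD(1)[OF R(1)]
    have e: "(P * R) *\<^sub>v unit_vec n j = P *\<^sub>v unit_vec n j" if "j < d" for j
      using Pc(1) GL_carrier[OF RG] GL_fixD(2)[OF R(1) that] by simp
    have ed: "(P * R) *\<^sub>v unit_vec n d = P *\<^sub>v y"
      using Pc(1) GL_carrier[OF RG] R(3) by simp
    have "good (Suc d) (P * R)"
      unfolding good_def
    proof (intro conjI allI impI)
      show "P * R \<in> GL n" using PG RG by (rule mult_in_GL)
      show "(P * R) *\<^sub>v unit_vec n 0 = v" using e[of 0] d P by (simp add: good_def)
      fix j assume j: "Suc j < Suc d"
      show "M *\<^sub>v ((P * R) *\<^sub>v unit_vec n j) = (P * R) *\<^sub>v unit_vec n (Suc j)"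
      proof (cases "Suc j = d")
        case True
        then have "d - 1 = j" "j < d" by simp_all
        then show ?thesis using e[of j] ed Py unfolding True by simp
      next
        case False
        then have "Suc j < d" using j by simp
        then show ?thesis using e[of j] e[of "Suc j"] P by (simp add: good_def)
      qed
    qed
    then have "Suc d \<in> Ds" using R(2) by (auto simp: Ds_def)
    then have "Suc d \<le> d" unfolding d_def by (intro Max_ge fin)
    then show False by simp
  qed
  then have "cyclic_shape n d (gl_inv P * M * P)"
    unfolding cyclic_shape_def y_def using P
    by (simp add: conj_mult_vec[OF PG M] good_def gl_inv_mult_vec(1)[OF PG])
  then show ?thesis using d P by (auto simp: good_def)
qed

section \<open>Counting block matrices\<close>

text \<open>Passes from the action on unit vectors, suited to changes of basis, to the block form
  suited to counting.\<close>

lemma cyclic_shape_four_block: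
  fixes N :: "'a :: field mat"
  assumes d: "1 \<le> d" and N: "N \<in> carrier_mat (d + m) (d + m)"
  shows "cyclic_shape (d + m) d N \<longleftrightarrow>
    (\<exists>z B D. z \<in> PiE {1..d} (\<lambda>_. UNIV) \<and> B \<in> carrier_mat d m \<and> D \<in> carrier_mat m m
       \<and> N = four_block_mat (companion d z) B (0\<^sub>m m d) D)" (is "_ \<longleftrightarrow> ?block")
proof
  assume sh: "cyclic_shape (d + m) d N"
  \<comment> \<open>Reads column \<open>d - 1\<close> upwards, matching the indexing of
    \<open>companion\<close>; \<open>restrict\<close> puts \<open>z\<close> into the extensional
    function space.\<close>
  define z where "z = restrict (\<lambda>i. N $$ (d - i, d - 1)) {1..d}"
  define B where "B = mat d m (\<lambda>(i, j). N $$ (i, d + j))"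
  define D where "D = mat m m (\<lambda>(i, j). N $$ (d + i, d + j))"
  have first: "N $$ (i, j) = (if i = Suc j then 1 else 0)" if "Suc j < d" "i < d + m" for i j
  proof -
    have "col N j = unit_vec (d + m) (Suc j)"
      using sh that mult_unit_vec[OF N, of j] by (simp add: cyclic_shape_def)
    then have "col N j $ i = unit_vec (d + m) (Suc j) $ i" by simp
    then show ?thesis using N that by simp
  qed
  have last: "N $$ (i, d - 1) = 0" if "d \<le> i" "i < d + m" for i
  proof -
    have "col N (d - 1) \<in> low_span (d + m) d"
      using sh d mult_unit_vec[OF N, of "d - 1"] by (simp add: cyclic_shape_def)
    then have "col N (d - 1) $ i = 0" using that by (simp add: low_span_def)
    then show ?thesis using N that d by simp
  qed
  have "N = four_block_mat (companion d z) B (0\<^sub>m m d) D"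
  proof (rule eq_matI)
    fix i j
    assume "i < dim_row (four_block_mat (companion d z) B (0\<^sub>m m d) D)"
      "j < dim_col (four_block_mat (companion d z) B (0\<^sub>m m d) D)"
    then have ij: "i < d + m" "j < d + m" by (simp_all add: companion_def D_def)
    consider "Suc j < d" | "Suc j = d" | "d \<le> j" by linarith
    then show "N $$ (i, j) = four_block_mat (companion d z) B (0\<^sub>m m d) D $$ (i, j)"
    proof cases
      case 1
      then show ?thesis using first[OF 1 ij(1)] ij by (cases "i < d") (simp_all add: companion_def D_def)
    next
      case 2
      then have "j = d - 1" by simp
      then show ?thesis using last[of i] ij 2 by (cases "i < d") (auto simp: companion_def D_def z_def)
    next
      case 3
      then show ?thesis using ij by (cases "i < d") (simp_all add: companion_def D_def B_def)
    qed
  qed (use N in \<open>simp_all add: companion_def D_def\<close>)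
  moreover have "z \<in> PiE {1..d} (\<lambda>_. UNIV)" unfolding z_def by (simp only: restrict_PiE_iff) simp
  moreover have "B \<in> carrier_mat d m" "D \<in> carrier_mat m m" by (simp_all add: B_def D_def)
  ultimately show ?block by blast
next
  assume ?block
  then obtain z B D where B: "B \<in> carrier_mat d m" and D: "D \<in> carrier_mat m m"
    and N_eq: "N = four_block_mat (companion d z) B (0\<^sub>m m d) D" by blast
  have entry: "N $$ (i, j) = (if i < d then companion d z $$ (i, j) else 0)" if "i < d + m" "j < d" for i j
    using that D unfolding N_eq by (simp add: companion_def)
  show "cyclic_shape (d + m) d N"
    unfolding cyclic_shape_def
  proof (intro conjI allI impI)
    fix j assume j: "Suc j < d"
    have "col N j = unit_vec (d + m) (Suc j)"
      using N j by (intro eq_vecI) (simp_all add: entry companion_def unit_vec_def)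
    then show "N *\<^sub>v unit_vec (d + m) j = unit_vec (d + m) (Suc j)"
      using mult_unit_vec[OF N, of j] j by simp
  next
    have "col N (d - 1) \<in> low_span (d + m) d"
      using N d carrier_vecI[of "col N (d - 1)" "d + m"] by (simp add: low_span_def entry)
    then show "N *\<^sub>v unit_vec (d + m) (d - 1) \<in> low_span (d + m) d"
      using mult_unit_vec[OF N, of "d - 1"] d by simp
  qed
qed

lemma companion_inject:
  assumes z: "z \<in> PiE {1..d} (\<lambda>_. UNIV)" "z' \<in> PiE {1..d} (\<lambda>_. UNIV)"
    and eq: "companion d z = companion d z'"
  shows "z = z'"
proof (rule PiE_ext[OF z])
  fix i assume i: "i \<in> {1..d}"
  have "companion d z $$ (d - i, d - 1) = companion d z' $$ (d - i, d - 1)" using eq by simp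
  then show "z i = z' i" using i by (simp add: companion_def)
qed

section \<open>Block form and size of the stabiliser\<close>

lemma GL_fix_four_block:
  fixes R :: "'a :: field mat"
  shows "R \<in> GL_fix (d + m) d \<longleftrightarrow>
    (\<exists>B D. B \<in> carrier_mat d m \<and> D \<in> GL m \<and> R = four_block_mat (1\<^sub>m d) B (0\<^sub>m m d) D)"
proof
  assume R: "R \<in> GL_fix (d + m) d"
  have Rc: "R \<in> carrier_mat (d + m) (d + m)" using GL_carrier GL_fixD(1) R by blast
  define B where "B = mat d m (\<lambda>(i, j). R $$ (i, d + j))"
  define D where "D = mat m m (\<lambda>(i, j). R $$ (d + i, d + j))"
  have c: "B \<in> carrier_mat d m" "D \<in> carrier_mat m m" by (simp_all add: B_def D_def)
  have first: "R $$ (i, j) = (if i = j then 1 else 0)" if "j < d" "i < d + m" for i j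
  proof -
    have "col R j = unit_vec (d + m) j"
      using GL_fixD(2)[OF R that(1)] that mult_unit_vec[OF Rc, of j] by simp
    then have "col R j $ i = unit_vec (d + m) j $ i" by simp
    then show ?thesis using Rc that by simp
  qed
  have eq: "R = four_block_mat (1\<^sub>m d) B (0\<^sub>m m d) D"
  proof (rule eq_matI)
    fix i j
    assume "i < dim_row (four_block_mat (1\<^sub>m d) B (0\<^sub>m m d) D)"
      "j < dim_col (four_block_mat (1\<^sub>m d) B (0\<^sub>m m d) D)"
    then have ij: "i < d + m" "j < d + m" by (simp_all add: D_def)
    then show "R $$ (i, j) = four_block_mat (1\<^sub>m d) B (0\<^sub>m m d) D $$ (i, j)"
      using first[of j i] by (cases "i < d"; cases "j < d") (simp_all add: D_def B_def)
  qed (use Rc in \<open>simp_all add: D_def\<close>)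
  have "D \<in> GL m"
    using four_block_in_GL_iff[OF one_carrier_mat c] GL_fixD(1)[OF R] eq by simp
  then show "\<exists>B D. B \<in> carrier_mat d m \<and> D \<in> GL m \<and> R = four_block_mat (1\<^sub>m d) B (0\<^sub>m m d) D"
    using c eq by blast
next
  assume "\<exists>B D. B \<in> carrier_mat d m \<and> D \<in> GL m \<and> R = four_block_mat (1\<^sub>m d) B (0\<^sub>m m d) D"
  then obtain B D where B: "B \<in> carrier_mat d m" and D: "D \<in> GL m"
    and R: "R = four_block_mat (1\<^sub>m d) B (0\<^sub>m m d) D" by blast
  note Dc = GL_carrier[OF D]
  have RG: "R \<in> GL (d + m)"
    unfolding R using four_block_in_GL_iff[OF one_carrier_mat B Dc] D one_in_GL by blast
  have "R *\<^sub>v unit_vec (d + m) j = unit_vec (d + m) j" if "j < d" for j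
  proof -
    have "R *\<^sub>v unit_vec (d + m) j = col R j"
      using that by (intro mult_unit_vec[OF GL_carrier[OF RG]]) simp
    also have "\<dots> = unit_vec (d + m) j"
      using that Dc by (intro eq_vecI) (simp_all add: R unit_vec_def)
    finally show ?thesis .
  qed
  then show "R \<in> GL_fix (d + m) d" using RG by (simp add: GL_fix_def)
qed

text \<open>The factor \<open>card (carrier_mat d m)\<close> also occurs in
  \<open>card_cyclic_shape\<close>, against which it cancels in
  \<open>card_cyclic_vecs\<close>.\<close>

lemma card_GL_fix:
  "card (GL_fix (d + m) d :: 'a :: {field, finite} mat set)
    = card (carrier_mat d m :: 'a mat set) * card (GL m :: 'a mat set)"
proof -
  let ?f = "\<lambda>(B :: 'a mat, D). four_block_mat (1\<^sub>m d) B (0\<^sub>m m d) D"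
  have "inj_on ?f (carrier_mat d m \<times> GL m)"
  proof (rule inj_onI, clarify)
    fix B D B' D' :: "'a mat"
    assume "B \<in> carrier_mat d m" "D \<in> GL m" "B' \<in> carrier_mat d m" "D' \<in> GL m"
      and "four_block_mat (1\<^sub>m d) B (0\<^sub>m m d) D = four_block_mat (1\<^sub>m d) B' (0\<^sub>m m d) D'"
    then show "B = B' \<and> D = D'"
      using four_block_mat_inject[OF one_carrier_mat _ _ one_carrier_mat] GL_carrier by meson
  qed
  moreover have "?f ` (carrier_mat d m \<times> GL m) = GL_fix (d + m) d"
  proof (intro equalityI subsetI)
    fix R :: "'a mat" assume "R \<in> GL_fix (d + m) d"
    then obtain B D where "B \<in> carrier_mat d m" "D \<in> GL m" "R = ?f (B, D)"
      unfolding GL_fix_four_block by auto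
    then show "R \<in> ?f ` (carrier_mat d m \<times> GL m)" by (intro image_eqI[where x = "(B, D)"]) simp_all
  next
    fix R :: "'a mat" assume "R \<in> ?f ` (carrier_mat d m \<times> GL m)"
    then show "R \<in> GL_fix (d + m) d" unfolding GL_fix_four_block by auto
  qed
  ultimately show ?thesis
    using card_image[of ?f "carrier_mat d m \<times> GL m"] by (simp only: card_cartesian_product)
qed

lemma finite_comp_solutions: "finite (comp_solutions d J b :: (nat \<Rightarrow> 'a :: {field, finite}) set)"
proof (rule finite_subset)
  show "comp_solutions d J b \<subseteq> PiE {1..d} (\<lambda>_. UNIV)" by (rule subsetI) (simp add: comp_solutions_def)
  show "finite (PiE {1..d} (\<lambda>_. UNIV :: 'a set))" by (rule finite_PiE) simp_all
qed

text \<open>The block \<open>B\<close> affects neither invertibility nor traces and is free. Once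
  \<open>D\<close> is chosen, the companion block must supply the remaining trace
  \<open>a i - mat_trace (D ^\<^sub>m i)\<close>.\<close>

lemma card_cyclic_shape:
  fixes a :: "nat \<Rightarrow> 'a :: {field, finite}"
  assumes d: "1 \<le> d"
  shows "card {N \<in> GL (d + m). cyclic_shape (d + m) d N \<and> (\<forall>i\<in>J. mat_trace (N ^\<^sub>m i) = a i)}
    = card (carrier_mat d m :: 'a mat set)
      * (\<Sum>D\<in>GL m. card (comp_solutions d J (\<lambda>i. a i - mat_trace (D ^\<^sub>m i))))"
    (is "card ?S = _")
proof -
  let ?Z = "\<lambda>D :: 'a mat. comp_solutions d J (\<lambda>i. a i - mat_trace (D ^\<^sub>m i))"
  let ?T = "(carrier_mat d m :: 'a mat set) \<times> Sigma (GL m) ?Z"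
  let ?f = "\<lambda>(B :: 'a mat, D, z). four_block_mat (companion d z) B (0\<^sub>m m d) D"
  have "inj_on ?f ?T"
  proof (rule inj_onI)
    fix x x' assume xx: "x \<in> ?T" "x' \<in> ?T" and eq: "?f x = ?f x'"
    obtain B D z where x: "x = (B, D, z)" by (cases x)
    obtain B' D' z' where x': "x' = (B', D', z')" by (cases x')
    have "companion d z = companion d z' \<and> B = B' \<and> D = D'"
      using xx eq unfolding x x'
      by (intro four_block_mat_inject[OF companion_carrier _ _ companion_carrier]) (auto simp: GL_carrier)
    then show "x = x'"
      using xx companion_inject[of z d z'] by (simp add: x x' comp_solutions_def)
  qed
  moreover have "?f ` ?T = ?S"
  proof (intro equalityI subsetI)
    fix N assume "N \<in> ?f ` ?T"
    then obtain B D z where B: "B \<in> carrier_mat d m" and D: "D \<in> GL m" and z: "z \<in> ?Z D"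
      and N: "N = four_block_mat (companion d z) B (0\<^sub>m m d) D" by auto
    note Dc = GL_carrier[OF D]
    have NG: "N \<in> GL (d + m)"
      unfolding N using four_block_in_GL_iff[OF companion_carrier B Dc] D z companion_in_GL_iff[OF d, of z]
      by (simp add: comp_solutions_def)
    have "cyclic_shape (d + m) d N"
      unfolding cyclic_shape_four_block[OF d GL_carrier[OF NG]]
      using B Dc z N by (auto simp: comp_solutions_def)
    moreover have "mat_trace (N ^\<^sub>m i) = a i" if "i \<in> J" for i
      unfolding N mat_trace_four_block_pow[OF companion_carrier B Dc]
      using z that by (simp add: comp_solutions_def)
    ultimately show "N \<in> ?S" using NG by simp
  next
    fix N assume "N \<in> ?S"
    then have NG: "N \<in> GL (d + m)" and sh: "cyclic_shape (d + m) d N"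
      and tr: "\<And>i. i \<in> J \<Longrightarrow> mat_trace (N ^\<^sub>m i) = a i" by auto
    obtain z B D where z: "z \<in> PiE {1..d} (\<lambda>_. UNIV)" and B: "B \<in> carrier_mat d m"
      and Dc: "D \<in> carrier_mat m m" and N: "N = four_block_mat (companion d z) B (0\<^sub>m m d) D"
      using sh unfolding cyclic_shape_four_block[OF d GL_carrier[OF NG]] by blast
    have D: "D \<in> GL m" and zd: "z d \<noteq> 0"
      using NG unfolding N four_block_in_GL_iff[OF companion_carrier B Dc] companion_in_GL_iff[OF d] by simp_all
    have "mat_trace (companion d z ^\<^sub>m i) = a i - mat_trace (D ^\<^sub>m i)" if "i \<in> J" for i
      using tr[OF that] unfolding N mat_trace_four_block_pow[OF companion_carrier B Dc] by (simp add: eq_diff_eq)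
    then have "z \<in> ?Z D" using z zd by (simp add: comp_solutions_def)
    then have "(B, D, z) \<in> ?T" using B D by simp
    then show "N \<in> ?f ` ?T" by (rule rev_image_eqI) (simp add: N)
  qed
  ultimately have "card ?S = card ?T" using card_image[of ?f ?T] by (simp only:)
  then show ?thesis
    by (simp add: card_cartesian_product card_SigmaI finite_GL finite_comp_solutions)
qed

section \<open>Double counting\<close>

definition trace_set :: "nat \<Rightarrow> nat set \<Rightarrow> (nat \<Rightarrow> 'a :: field) \<Rightarrow> 'a mat set" where
  "trace_set n J a = {M \<in> GL n. \<forall>i\<in>J. mat_trace (M ^\<^sub>m i) = a i}"

text \<open>The columns of \<open>P\<close> form a basis adapted to \<open>M\<close>, and
  \<open>gl_inv P * M * P\<close> is \<open>M\<close> written in that basis.\<close>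

definition cyclic_pairs :: "nat \<Rightarrow> nat set \<Rightarrow> (nat \<Rightarrow> 'a :: field) \<Rightarrow> nat \<Rightarrow> ('a mat \<times> 'a mat) set" where
  "cyclic_pairs n J a d = {(M, P). M \<in> trace_set n J a \<and> P \<in> GL n \<and> cyclic_shape n d (gl_inv P * M * P)}"

text \<open>Forgets all of the basis but its first vector. For \<open>1 \<le> d \<le> n\<close> this
  leaves the pairs of \<open>M\<close> and a vector generating a cyclic subspace of dimension
  \<open>d\<close>.\<close>

definition cyclic_vecs :: "nat \<Rightarrow> nat set \<Rightarrow> (nat \<Rightarrow> 'a :: field) \<Rightarrow> nat \<Rightarrow> ('a mat \<times> 'a vec) set" where
  "cyclic_vecs n J a d = (\<lambda>(M, P). (M, P *\<^sub>v unit_vec n 0)) ` cyclic_pairs n J a d"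

section \<open>Conjugation invariance and the count of adapted pairs\<close>

lemma gl_conj_cancel:
  assumes P: "P \<in> GL n" and M: "M \<in> carrier_mat n n"
  shows "P * (gl_inv P * M * P) * gl_inv P = M" "gl_inv P * (P * M * gl_inv P) * P = M"
proof -
  note c = GL_carrier[OF P] gl_inv_carrier[OF P] M
  have "P * (gl_inv P * M * P) * gl_inv P = (P * gl_inv P) * M * (P * gl_inv P)"
    using c by (simp add: assoc_mult_mat[of _ n n _ n _ n])
  then show "P * (gl_inv P * M * P) * gl_inv P = M" using c by (simp add: gl_inv_right[OF P])
  have "gl_inv P * (P * M * gl_inv P) * P = (gl_inv P * P) * M * (gl_inv P * P)"
    using c by (simp add: assoc_mult_mat[of _ n n _ n _ n])
  then show "gl_inv P * (P * M * gl_inv P) * P = M" using c by (simp add: gl_inv_left[OF P])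
qed

lemma conj_in_trace_set:
  assumes P: "P \<in> GL n" and N: "N \<in> trace_set n J a"
  shows "P * N * gl_inv P \<in> trace_set n J a"
proof -
  have NG: "N \<in> GL n" using N by (simp add: trace_set_def)
  have "P * N * gl_inv P \<in> GL n" by (intro mult_in_GL P NG gl_inv_in_GL)
  then show ?thesis using N mat_trace_conj_pow[OF GL_carrier[OF NG] P] by (simp add: trace_set_def)
qed

lemma conj_inv_in_trace_set:
  assumes P: "P \<in> GL n" and M: "M \<in> trace_set n J a"
  shows "gl_inv P * M * P \<in> trace_set n J a"
proof -
  have MG: "M \<in> GL n" using M by (simp add: trace_set_def)
  let ?N = "gl_inv P * M * P"
  have N: "?N \<in> GL n" by (intro mult_in_GL P MG gl_inv_in_GL)
  have "mat_trace (?N ^\<^sub>m i) = mat_trace (M ^\<^sub>m i)" for i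
    using mat_trace_conj_pow[OF GL_carrier[OF N] P, of i] gl_conj_cancel(1)[OF P GL_carrier[OF MG]] by simp
  then show ?thesis using N M by (simp add: trace_set_def)
qed

lemma finite_trace_set: "finite (trace_set n J a :: 'a :: {field, finite} mat set)"
  by (rule finite_subset[OF _ finite_GL[of n]]) (simp add: trace_set_def subset_iff)

lemma finite_cyclic_pairs: "finite (cyclic_pairs n J a d :: ('a :: {field, finite} mat \<times> 'a mat) set)"
  by (rule finite_subset[OF _ finite_cartesian_product[OF finite_trace_set[of n J a] finite_GL[of n]]])
    (clarsimp simp: cyclic_pairs_def)

text \<open>Replacing \<open>M\<close> by its matrix in the basis \<open>P\<close> decouples the two
  components, because \<open>trace_set\<close> is invariant under conjugation.\<close>

lemma card_cyclic_pairs: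
  fixes a :: "nat \<Rightarrow> 'a :: {field, finite}"
  shows "card (cyclic_pairs n J a d) = card {N \<in> trace_set n J a. cyclic_shape n d N} * card (GL n :: 'a mat set)"
proof -
  let ?f = "\<lambda>(N :: 'a mat, P). (P * N * gl_inv P, P)"
  let ?g = "\<lambda>(M :: 'a mat, P). (gl_inv P * M * P, P)"
  let ?A = "{N \<in> trace_set n J a. cyclic_shape n d N} \<times> (GL n :: 'a mat set)"
  have tc: "N \<in> carrier_mat n n" if "N \<in> trace_set n J a" for N
    using that by (simp add: trace_set_def GL_carrier)
  have "bij_betw ?f ?A (cyclic_pairs n J a d)"
  proof (rule bij_betw_byWitness[where f' = ?g])
    show "\<forall>x\<in>?A. ?g (?f x) = x" by (clarsimp simp: gl_conj_cancel(2) tc)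
    show "\<forall>x\<in>cyclic_pairs n J a d. ?f (?g x) = x"
      by (clarsimp simp: cyclic_pairs_def gl_conj_cancel(1) tc)
    show "?f ` ?A \<subseteq> cyclic_pairs n J a d"
      by (clarsimp simp: cyclic_pairs_def gl_conj_cancel(2) tc conj_in_trace_set)
    show "?g ` cyclic_pairs n J a d \<subseteq> ?A"
      by (clarsimp simp: cyclic_pairs_def conj_inv_in_trace_set)
  qed
  from bij_betw_same_card[OF this] show ?thesis by (simp add: card_cartesian_product)
qed

text \<open>The transition matrix \<open>gl_inv P * Q\<close> intertwines the two forms of
  \<open>M\<close> and fixes the first unit vector, so the results on intertwiners apply; using them
  in both directions gives \<open>d = e\<close>.\<close>

lemma two_cyclic_bases:
  fixes M :: "'a :: field mat"
  assumes M: "M \<in> carrier_mat n n" and P: "P \<in> GL n" and Q: "Q \<in> GL n"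
    and eq: "P *\<^sub>v unit_vec n 0 = Q *\<^sub>v unit_vec n 0"
    and d: "d \<in> {1..n}" "cyclic_shape n d (gl_inv P * M * P)"
    and e: "e \<in> {1..n}" "cyclic_shape n e (gl_inv Q * M * Q)"
  shows "d = e" "gl_inv P * Q \<in> GL_fix n d"
proof -
  \<comment> \<open>Proved for arbitrary \<open>P\<close> and \<open>Q\<close>, so that it can be
    used again with the two bases exchanged.\<close>
  have *: "gl_inv P * Q \<in> GL n" "gl_inv P * M * P \<in> carrier_mat n n"
      "gl_inv P * M * P * (gl_inv P * Q) = gl_inv P * Q * (gl_inv Q * M * Q)"
      "gl_inv P * Q *\<^sub>v unit_vec n 0 = unit_vec n 0"
    if P: "P \<in> GL n" and Q: "Q \<in> GL n" and eq: "P *\<^sub>v unit_vec n 0 = Q *\<^sub>v unit_vec n 0" for P Q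
  proof -
    note c = GL_carrier[OF P] gl_inv_carrier[OF P] GL_carrier[OF Q] gl_inv_carrier[OF Q] M
    show "gl_inv P * Q \<in> GL n" by (intro mult_in_GL gl_inv_in_GL P Q)
    show "gl_inv P * M * P \<in> carrier_mat n n" using c by simp
    have "gl_inv P * M * P * (gl_inv P * Q) = gl_inv P * M * (P * gl_inv P) * Q"
      using c by (simp add: assoc_mult_mat[of _ n n _ n _ n])
    also have "\<dots> = gl_inv P * M * Q" using c by (simp add: gl_inv_right[OF P])
    finally have 1: "gl_inv P * M * P * (gl_inv P * Q) = gl_inv P * M * Q" .
    have "gl_inv P * Q * (gl_inv Q * M * Q) = gl_inv P * (Q * gl_inv Q) * M * Q"
      using c by (simp add: assoc_mult_mat[of _ n n _ n _ n])
    also have "\<dots> = gl_inv P * M * Q" using c by (simp add: gl_inv_right[OF Q])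
    finally show "gl_inv P * M * P * (gl_inv P * Q) = gl_inv P * Q * (gl_inv Q * M * Q)"
      using 1 by simp
    have "gl_inv P * Q *\<^sub>v unit_vec n 0 = gl_inv P *\<^sub>v (Q *\<^sub>v unit_vec n 0)"
      using c by (simp add: assoc_mult_mat_vec[of _ n n _ n])
    also have "\<dots> = unit_vec n 0"
      unfolding eq[symmetric] by (rule gl_inv_mult_vec(1)[OF P]) simp
    finally show "gl_inv P * Q *\<^sub>v unit_vec n 0 = unit_vec n 0" .
  qed
  note PQ = *[OF P Q eq] and QP = *[OF Q P eq[symmetric]]
  have d': "1 \<le> d" "d \<le> n" and e': "1 \<le> e" "e \<le> n" using d e by simp_all
  have "e \<le> d" by (rule cyclic_shape_le[OF PQ(1,2) QP(2) PQ(3,4) d' d(2) e'(2) e(2)])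
  moreover have "d \<le> e" by (rule cyclic_shape_le[OF QP(1,2) PQ(2) QP(3,4) e' e(2) d'(2) d(2)])
  ultimately show "d = e" by simp
  have "gl_inv P * Q *\<^sub>v unit_vec n j = unit_vec n j" if "j < d" for j
    using cyclic_shape_fixes[OF GL_carrier[OF PQ(1)] PQ(2) QP(2) PQ(3,4) d'(2) d(2) e'(2) e(2)]
      that \<open>d = e\<close> by simp
  then show "gl_inv P * Q \<in> GL_fix n d" using PQ(1) by (simp add: GL_fix_def)
qed

text \<open>Converse of \<open>two_cyclic_bases\<close>: on the first \<open>d\<close> unit vectors
  the new form of \<open>M\<close> is the old one followed by the inverse of \<open>R\<close>, which
  fixes \<open>low_span n d\<close> pointwise.\<close>

lemma GL_fix_cyclic_basis:
  fixes M :: "'a :: field mat"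
  assumes M: "M \<in> carrier_mat n n" and P: "P \<in> GL n" and R: "R \<in> GL_fix n d"
    and d: "d \<in> {1..n}" "cyclic_shape n d (gl_inv P * M * P)"
  shows "cyclic_shape n d (gl_inv (P * R) * M * (P * R))"
    "(P * R) *\<^sub>v unit_vec n 0 = P *\<^sub>v unit_vec n 0"
proof -
  note RG = GL_fixD(1)[OF R] and Re = GL_fixD(2)[OF R]
  note c = GL_carrier[OF P] gl_inv_carrier[OF P] GL_carrier[OF RG] gl_inv_carrier[OF RG] M
  have PR: "P * R \<in> GL n" by (rule mult_in_GL[OF P RG])
  have PRv: "(P * R) *\<^sub>v unit_vec n j = P *\<^sub>v unit_vec n j" if "j < d" for j
    using c Re[OF that] by simp
  show "(P * R) *\<^sub>v unit_vec n 0 = P *\<^sub>v unit_vec n 0" using PRv d by simp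
  define N where "N = gl_inv P * M * P"
  have N: "N \<in> carrier_mat n n" using c by (simp add: N_def)
  define R' where "R' = gl_inv R"
  have R'e: "R' *\<^sub>v unit_vec n j = unit_vec n j" if "j < d" for j
    unfolding R'_def by (rule gl_inv_fixes[OF RG _ Re[OF that]]) simp
  \<comment> \<open>Instead of a product formula for \<open>gl_inv\<close>, the claimed value is
    multiplied by \<open>P * R\<close> and the result cancelled.\<close>
  have key: "(gl_inv (P * R) * M * (P * R)) *\<^sub>v unit_vec n j = R' *\<^sub>v (N *\<^sub>v unit_vec n j)" if "j < d" for j
  proof -
    let ?w = "M *\<^sub>v (P *\<^sub>v unit_vec n j)"
    have w: "?w \<in> carrier_vec n" using c by (intro mult_mat_vec_carrier[OF M] mult_mat_vec_carrier[OF c(1)]) simp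
    have "(P * R) *\<^sub>v (R' *\<^sub>v (gl_inv P *\<^sub>v ?w)) = P *\<^sub>v (R *\<^sub>v (R' *\<^sub>v (gl_inv P *\<^sub>v ?w)))"
      using c w by (intro assoc_mult_mat_vec[of _ n n _ n]) (simp_all add: R'_def)
    also have "R *\<^sub>v (R' *\<^sub>v (gl_inv P *\<^sub>v ?w)) = gl_inv P *\<^sub>v ?w"
      unfolding R'_def using c w by (intro gl_inv_mult_vec(2)[OF RG]) simp
    also have "P *\<^sub>v (gl_inv P *\<^sub>v ?w) = ?w" by (rule gl_inv_mult_vec(2)[OF P w])
    finally have "gl_inv (P * R) *\<^sub>v ?w = gl_inv (P * R) *\<^sub>v ((P * R) *\<^sub>v (R' *\<^sub>v (gl_inv P *\<^sub>v ?w)))"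
      by simp
    also have "\<dots> = R' *\<^sub>v (gl_inv P *\<^sub>v ?w)"
      using c w by (intro gl_inv_mult_vec(1)[OF PR]) (simp add: R'_def)
    finally show ?thesis
      by (simp add: conj_mult_vec[OF PR M] conj_mult_vec[OF P M] PRv[OF that] N_def)
  qed
  have sh: "cyclic_shape n d N" using d by (simp add: N_def)
  show "cyclic_shape n d (gl_inv (P * R) * M * (P * R))"
    unfolding cyclic_shape_def
  proof (intro conjI allI impI)
    fix j assume j: "Suc j < d"
    then show "(gl_inv (P * R) * M * (P * R)) *\<^sub>v unit_vec n j = unit_vec n (Suc j)"
      using key[of j] R'e[OF j] sh by (simp add: cyclic_shape_def)
  next
    have x: "N *\<^sub>v unit_vec n (d - 1) \<in> low_span n d" using sh by (simp add: cyclic_shape_def)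
    have "R' *\<^sub>v (N *\<^sub>v unit_vec n (d - 1)) = N *\<^sub>v unit_vec n (d - 1)"
      using c d by (intro fix_low_span[OF _ _ R'e x]) (simp_all add: R'_def)
    then show "(gl_inv (P * R) * M * (P * R)) *\<^sub>v unit_vec n (d - 1) \<in> low_span n d"
      using key[of "d - 1"] d x by simp
  qed
qed

text \<open>The adapted bases with the same matrix and first vector form the coset of products
  \<open>P * R\<close> with \<open>R\<close> in \<open>GL_fix n d\<close>.\<close>

lemma card_cyclic_vecs_fibre:
  fixes a :: "nat \<Rightarrow> 'a :: {field, finite}"
  assumes d: "d \<in> {1..n}" and MP: "(M, P) \<in> cyclic_pairs n J a d"
  shows "card {x \<in> cyclic_pairs n J a d. (case x of (M, P) \<Rightarrow> (M, P *\<^sub>v unit_vec n 0)) = (M, P *\<^sub>v unit_vec n 0)}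
    = card (GL_fix n d :: 'a mat set)" (is "card ?F = _")
proof -
  have MT: "M \<in> trace_set n J a" and P: "P \<in> GL n" and sh: "cyclic_shape n d (gl_inv P * M * P)"
    using MP by (simp_all add: cyclic_pairs_def)
  have M: "M \<in> carrier_mat n n" using MT by (simp add: trace_set_def GL_carrier)
  note c = GL_carrier[OF P] gl_inv_carrier[OF P] M
  let ?f = "\<lambda>R. (M, P * R)"
  have left: "gl_inv P * (P * R) = R" if "R \<in> carrier_mat n n" for R
  proof -
    have "gl_inv P * (P * R) = gl_inv P * P * R" using c that by (simp add: assoc_mult_mat[of _ n n _ n _ n])
    then show ?thesis using that by (simp add: gl_inv_left[OF P])
  qed
  have right: "P * (gl_inv P * Q) = Q" if "Q \<in> carrier_mat n n" for Q
  proof -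
    have "P * (gl_inv P * Q) = P * gl_inv P * Q" using c that by (simp add: assoc_mult_mat[of _ n n _ n _ n])
    then show ?thesis using that by (simp add: gl_inv_right[OF P])
  qed
  have "inj_on ?f (GL_fix n d)"
  proof (rule inj_onI)
    fix R R' assume R: "R \<in> GL_fix n d" "R' \<in> GL_fix n d" and "?f R = ?f R'"
    then have "gl_inv P * (P * R) = gl_inv P * (P * R')" by simp
    moreover have "R \<in> carrier_mat n n" "R' \<in> carrier_mat n n"
      using R by (simp_all add: GL_fix_def GL_carrier)
    ultimately show "R = R'" by (simp only: left)
  qed
  moreover have "?f ` GL_fix n d = ?F"
  proof (intro equalityI subsetI)
    fix x assume "x \<in> ?f ` GL_fix n d"
    then obtain R where R: "R \<in> GL_fix n d" and x: "x = (M, P * R)" by (rule imageE)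
    have "P * R \<in> GL n" by (rule mult_in_GL[OF P GL_fixD(1)[OF R]])
    then show "x \<in> ?F" using GL_fix_cyclic_basis[OF M P R d sh] MT by (simp add: x cyclic_pairs_def)
  next
    fix x assume "x \<in> ?F"
    then obtain Q where x: "x = (M, Q)" and Q: "Q \<in> GL n" "cyclic_shape n d (gl_inv Q * M * Q)"
      "Q *\<^sub>v unit_vec n 0 = P *\<^sub>v unit_vec n 0"
      by (cases x) (simp add: cyclic_pairs_def)
    have "gl_inv P * Q \<in> GL_fix n d"
      by (rule two_cyclic_bases(2)[OF M P Q(1) Q(3)[symmetric] d sh d Q(2)])
    then show "x \<in> ?f ` GL_fix n d"
      by (rule rev_image_eqI) (simp add: x right[OF GL_carrier[OF Q(1)]])
  qed
  ultimately show ?thesis using card_image[of ?f "GL_fix n d"] by (simp only:)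
qed

lemma card_cyclic_vecs_GL_fix:
  fixes a :: "nat \<Rightarrow> 'a :: {field, finite}"
  assumes d: "d \<in> {1..n}"
  shows "card (cyclic_vecs n J a d) * card (GL_fix n d :: 'a mat set) = card (cyclic_pairs n J a d)"
proof -
  let ?g = "\<lambda>(M :: 'a mat, P). (M, P *\<^sub>v unit_vec n 0)"
  let ?X = "cyclic_pairs n J a d"
  have "card ?X = (\<Sum>y\<in>?g ` ?X. \<Sum>x\<in>{x \<in> ?X. ?g x = y}. 1)"
    using sum.image_gen[OF finite_cyclic_pairs, of "\<lambda>_. 1 :: nat" n J a d ?g] by simp
  also have "\<dots> = (\<Sum>y\<in>?g ` ?X. card (GL_fix n d :: 'a mat set))"
  proof (intro sum.cong refl)
    fix y assume "y \<in> ?g ` ?X"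
    then obtain M P where "(M, P) \<in> ?X" "y = (M, P *\<^sub>v unit_vec n 0)" by auto
    then show "(\<Sum>x\<in>{x \<in> ?X. ?g x = y}. 1) = card (GL_fix n d :: 'a mat set)"
      using card_cyclic_vecs_fibre[OF d, of M P J a] by simp
  qed
  finally show ?thesis by (simp add: cyclic_vecs_def)
qed

text \<open>The division-free form of averaging over a uniform \<open>D\<close>: after the number of
  blocks \<open>B\<close> is cancelled, \<open>card (GL (n - d))\<close> stays on the left and the
  sum over \<open>D\<close> on the right.\<close>

lemma card_cyclic_vecs:
  fixes a :: "nat \<Rightarrow> 'a :: {field, finite}"
  assumes d: "d \<in> {1..n}"
  shows "card (cyclic_vecs n J a d) * card (GL (n - d) :: 'a mat set)
    = card (GL n :: 'a mat set)
      * (\<Sum>D\<in>GL (n - d). card (comp_solutions d J (\<lambda>i. a i - mat_trace (D ^\<^sub>m i))))"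
proof -
  define m where "m = n - d"
  have n: "n = d + m" and d1: "1 \<le> d" using d by (simp_all add: m_def)
  let ?c = "card (carrier_mat d m :: 'a mat set)"
  let ?S = "\<Sum>D\<in>GL m. card (comp_solutions d J (\<lambda>i. a i - mat_trace (D ^\<^sub>m i)))"
  have "0\<^sub>m d m \<in> (carrier_mat d m :: 'a mat set)" by simp
  then have c: "?c > 0" using finite_carrier_mat card_gt_0_iff by blast
  have "{N \<in> trace_set n J a. cyclic_shape n d N}
      = {N \<in> GL (d + m). cyclic_shape (d + m) d N \<and> (\<forall>i\<in>J. mat_trace (N ^\<^sub>m i) = a i)}"
    unfolding n trace_set_def by blast
  then have "card (cyclic_vecs n J a d) * (?c * card (GL m :: 'a mat set)) = ?c * ?S * card (GL n :: 'a mat set)"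
    using card_cyclic_vecs_GL_fix[OF d, of J a] card_cyclic_pairs[of n J a d] card_cyclic_shape[OF d1, of m J a]
      card_GL_fix[of d m, where 'a = 'a] n by simp
  then have "?c * (card (cyclic_vecs n J a d) * card (GL m :: 'a mat set)) = ?c * (card (GL n :: 'a mat set) * ?S)"
    by (simp only: mult_ac)
  then show ?thesis using c unfolding m_def[symmetric] by simp
qed

text \<open>Each nonzero vector generates, under a given \<open>M\<close>, a cyclic subspace of
  exactly one dimension, so the sets for different \<open>d\<close> partition the pairs of a matrix
  and a nonzero vector.\<close>

lemma sum_card_cyclic_vecs:
  fixes a :: "nat \<Rightarrow> 'a :: {field, finite}"
  assumes n: "1 \<le> n"
  shows "(\<Sum>d\<in>{1..n}. card (cyclic_vecs n J a d)) = card (trace_set n J a) * (CARD('a) ^ n - 1)"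
proof -
  have disj: "cyclic_vecs n J a d \<inter> cyclic_vecs n J a e = {}" if "d \<in> {1..n}" "e \<in> {1..n}" "d \<noteq> e" for d e
  proof (rule ccontr)
    assume "cyclic_vecs n J a d \<inter> cyclic_vecs n J a e \<noteq> {}"
    then obtain M P Q where "(M, P) \<in> cyclic_pairs n J a d" "(M, Q) \<in> cyclic_pairs n J a e"
      and eq: "P *\<^sub>v unit_vec n 0 = Q *\<^sub>v unit_vec n 0"
      unfolding cyclic_vecs_def by auto
    then have "M \<in> carrier_mat n n" "P \<in> GL n" "Q \<in> GL n"
      "cyclic_shape n d (gl_inv P * M * P)" "cyclic_shape n e (gl_inv Q * M * Q)"
      by (simp_all add: cyclic_pairs_def trace_set_def GL_carrier)
    then show False using two_cyclic_bases(1)[of M n P Q d e] eq that by simp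
  qed
  have "(\<Union>d\<in>{1..n}. cyclic_vecs n J a d) = trace_set n J a \<times> (carrier_vec n - {0\<^sub>v n :: 'a vec})"
  proof (intro equalityI subsetI)
    fix x assume "x \<in> (\<Union>d\<in>{1..n}. cyclic_vecs n J a d)"
    then obtain d M P where x: "x = (M, P *\<^sub>v unit_vec n 0)" and "(M, P) \<in> cyclic_pairs n J a d"
      unfolding cyclic_vecs_def by auto
    then have M: "M \<in> trace_set n J a" and P: "P \<in> GL n" by (simp_all add: cyclic_pairs_def)
    have "P *\<^sub>v unit_vec n 0 \<noteq> 0\<^sub>v n"
    proof
      assume "P *\<^sub>v unit_vec n 0 = 0\<^sub>v n"
      then have "unit_vec n 0 = (0\<^sub>v n :: 'a vec)" using P by (simp add: GL_iff_kernel)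
      then have "unit_vec n 0 $ 0 = (0\<^sub>v n :: 'a vec) $ 0" by simp
      then show False using n by simp
    qed
    moreover have "P *\<^sub>v unit_vec n 0 \<in> carrier_vec n"
      by (rule mult_mat_vec_carrier[OF GL_carrier[OF P]]) simp
    ultimately show "x \<in> trace_set n J a \<times> (carrier_vec n - {0\<^sub>v n :: 'a vec})" using M x by simp
  next
    fix x assume "x \<in> trace_set n J a \<times> (carrier_vec n - {0\<^sub>v n :: 'a vec})"
    then obtain M v where x: "x = (M, v)" and M: "M \<in> trace_set n J a"
      and v: "v \<in> carrier_vec n" "v \<noteq> 0\<^sub>v n" by auto
    have "M \<in> carrier_mat n n" using M by (simp add: trace_set_def GL_carrier)
    from exists_cyclic_basis[OF this v] obtain d P where d: "d \<in> {1..n}" and P: "P \<in> GL n"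
      "P *\<^sub>v unit_vec n 0 = v" "cyclic_shape n d (gl_inv P * M * P)" by blast
    then have "(M, P) \<in> cyclic_pairs n J a d" using M by (simp add: cyclic_pairs_def)
    then have "x \<in> cyclic_vecs n J a d"
      unfolding cyclic_vecs_def by (rule rev_image_eqI) (simp add: x P(2))
    then show "x \<in> (\<Union>d\<in>{1..n}. cyclic_vecs n J a d)" using d by blast
  qed
  moreover have "card (\<Union>d\<in>{1..n}. cyclic_vecs n J a d) = (\<Sum>d\<in>{1..n}. card (cyclic_vecs n J a d))"
    using disj by (intro card_UN_disjoint) (simp_all add: cyclic_vecs_def finite_cyclic_pairs)
  ultimately have "(\<Sum>d\<in>{1..n}. card (cyclic_vecs n J a d)) = card (trace_set n J a \<times> (carrier_vec n - {0\<^sub>v n :: 'a vec}))"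
    by (simp only:)
  then show ?thesis
    by (simp add: card_cartesian_product card_Diff_singleton card_carrier_vec)
qed

section \<open>The trace distribution\<close>

text \<open>The companion count is the same for every right-hand side, hence for every
  \<open>D\<close>, and the average over \<open>D\<close> collapses.\<close>

lemma card_cyclic_vecs_eq:
  fixes a :: "nat \<Rightarrow> 'a :: {field, finite}"
  assumes d: "d \<in> {1..n}" and J: "J \<subseteq> {1..<d}" "\<And>i. i \<in> J \<Longrightarrow> of_nat i \<noteq> (0 :: 'a)"
  shows "card (cyclic_vecs n J a d) * CARD('a) ^ card J
    = card (GL n :: 'a mat set) * ((CARD('a) - 1) * CARD('a) ^ (d - 1))"
proof -
  let ?g = "card (GL (n - d) :: 'a mat set)"
  have g: "?g > 0" using one_in_GL finite_GL card_gt_0_iff by blast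
  have "?g * (card (cyclic_vecs n J a d) * CARD('a) ^ card J)
      = card (GL n :: 'a mat set) * (\<Sum>D\<in>(GL (n - d) :: 'a mat set).
          card (comp_solutions d J (\<lambda>i. a i - mat_trace (D ^\<^sub>m i))) * CARD('a) ^ card J)"
    using arg_cong[OF card_cyclic_vecs[OF d, of J a], of "\<lambda>c. c * CARD('a) ^ card J"]
    unfolding sum_distrib_right[symmetric] by (simp only: mult_ac)
  also have "\<dots> = ?g * (card (GL n :: 'a mat set) * ((CARD('a) - 1) * CARD('a) ^ (d - 1)))"
    using d by (simp add: card_comp_solutions[OF J])
  finally show ?thesis using g by (simp only: mult_cancel1) simp
qed

text \<open>The companion bound is uniform in \<open>D\<close>, so the average over \<open>D\<close>
  inherits it.\<close>

lemma card_cyclic_vecs_le: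
  fixes a :: "nat \<Rightarrow> 'a :: {field, finite}"
  assumes d: "d \<in> {1..n}" and J: "\<And>i. i \<in> J \<Longrightarrow> of_nat i \<noteq> (0 :: 'a)"
  shows "card (cyclic_vecs n J a d) \<le> card (GL n :: 'a mat set) * CARD('a) ^ (d - card (J \<inter> {1..d}))"
proof -
  let ?g = "card (GL (n - d) :: 'a mat set)"
  have g: "?g > 0" using one_in_GL finite_GL card_gt_0_iff by blast
  have "(\<Sum>D\<in>GL (n - d). card (comp_solutions d J (\<lambda>i. a i - mat_trace (D ^\<^sub>m i))))
      \<le> ?g * CARD('a) ^ (d - card (J \<inter> {1..d}))"
    using sum_bounded_above[of "GL (n - d)" "\<lambda>D. card (comp_solutions d J (\<lambda>i. a i - mat_trace (D ^\<^sub>m i)))"]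
      card_comp_solutions_le[OF J] by simp
  then have "card (cyclic_vecs n J a d) * ?g
      \<le> card (GL n :: 'a mat set) * (?g * CARD('a) ^ (d - card (J \<inter> {1..d})))"
    unfolding card_cyclic_vecs[OF d] by (rule mult_le_mono2)
  then have "?g * card (cyclic_vecs n J a d)
      \<le> ?g * (card (GL n :: 'a mat set) * CARD('a) ^ (d - card (J \<inter> {1..d})))"
    by (simp only: mult_ac)
  then show ?thesis using g by (simp only: nat_mult_le_cancel1)
qed

text \<open>Applied with \<open>x\<close> the probability, \<open>N\<close> the power
  \<open>q ^ n\<close>, \<open>A\<close> and \<open>Q\<close> the powers of \<open>q\<close> with
  \<open>A * Q = q ^ k\<close>, and \<open>e\<close> the share of dimensions up to \<open>k\<close>.
  The deviation of \<open>x\<close> from \<open>1 / A\<close>, times \<open>N - 1\<close>, is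
  \<open>e - Q + 1 / A\<close>, which lies between \<open>- Q\<close> and
  \<open>k * Q\<close>.\<close>

lemma recursion_bound:
  fixes x :: real
  assumes eq: "x * (N - 1) = e + (N - A * Q) / A" and e: "0 \<le> e" "e \<le> real k * Q"
    and A: "1 \<le> A" and Q: "1 \<le> Q" and N: "real k + 1 \<le> N" and k: "1 \<le> k"
  shows "\<bar>x - 1 / A\<bar> \<le> real (k + 1) * Q / N"
proof -
  have N1: "N - 1 > 0" using N k by simp
  have eq': "(x - 1 / A) * (N - 1) = e - Q + 1 / A"
    using eq A by (simp add: field_simps)
  have A1: "0 \<le> 1 / A" "1 / A \<le> Q"
    using A Q order_trans[of "1 / A" 1 Q] by simp_all
  have "real k * Q \<ge> Q" using k Q by simp
  then have "\<bar>(x - 1 / A) * (N - 1)\<bar> \<le> real k * Q"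
    unfolding eq' using e A1 by linarith
  then have "\<bar>x - 1 / A\<bar> * (N - 1) \<le> real k * Q"
    using N1 by (simp add: abs_mult)
  \<comment> \<open>Trading the denominator \<open>N - 1\<close> for \<open>N\<close> raises
    \<open>k\<close> to \<open>k + 1\<close>; after clearing denominators this is exactly
    \<open>k + 1 \<le> N\<close>.\<close>
  also have "real k * Q \<le> real (k + 1) * Q / N * (N - 1)"
  proof -
    have "real k * N \<le> real (k + 1) * (N - 1)" using N by (simp add: algebra_simps)
    then have "Q * (real k * N) \<le> Q * (real (k + 1) * (N - 1))" using Q by (intro mult_left_mono) simp_all
    then show ?thesis using N1 by (simp add: field_simps)
  qed
  finally show ?thesis using N1 by (rule mult_right_le_imp_le)
qed

theorem theorem1p10:
  fixes n k :: nat and a :: "nat \<Rightarrow> 'a :: {finite, field}"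
  assumes "1 \<le> k" and "k \<le> n"
  shows "\<bar> real (card {M \<in> GL n. \<forall>i\<in>{1..k}. \<not> CHAR('a) dvd i \<longrightarrow> mat_trace (M ^\<^sub>m i) = a i})
             / real (card (GL n :: 'a mat set))
           - 1 / real (CARD('a)) ^ (k - k div CHAR('a)) \<bar>
         \<le> real (k + 1) * real (CARD('a)) ^ (k div CHAR('a)) / real (CARD('a)) ^ n"
proof -
  define q where "q = CARD('a)"
  define p where "p = CHAR('a)"
  define J where "J = {i \<in> {1..k}. \<not> p dvd i}"
  define m where "m = k - k div p"
  define G where "G = card (GL n :: 'a mat set)"
  define Y where "Y d = card (cyclic_vecs n J a d)" for d
  have p: "p > 0" unfolding p_def by (rule finite_imp_CHAR_pos) simp
  have "card {0, 1 :: 'a} \<le> q" unfolding q_def by (rule card_mono) simp_all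
  then have q: "q \<ge> 2" by simp
  have G: "G > 0" unfolding G_def using one_in_GL finite_GL card_gt_0_iff by blast
  have J0: "of_nat i \<noteq> (0 :: 'a)" if "i \<in> J" for i
    using that by (simp add: J_def p_def of_nat_eq_0_iff_char_dvd)
  have cJ: "card J = m" unfolding J_def m_def by (rule card_not_dvd[OF p])
  have set: "{M \<in> GL n. \<forall>i\<in>{1..k}. \<not> CHAR('a) dvd i \<longrightarrow> mat_trace (M ^\<^sub>m i) = a i} = trace_set n J a"
    unfolding trace_set_def J_def p_def by blast
  have kp: "k div p \<le> k" by simp
  \<comment> \<open>For \<open>d \<le> k\<close> the conditions in range number
    \<open>d - d div p\<close>, leaving the exponent \<open>d div p\<close>, which is at most
    \<open>k div p\<close>.\<close>
  have low: "real (Y d) \<le> real G * real q ^ (k div p)" if d: "d \<in> {1..k}" for d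
  proof -
    have "J \<inter> {1..d} = {i \<in> {1..d}. \<not> p dvd i}" using d by (auto simp: J_def)
    then have "d - card (J \<inter> {1..d}) = d div p" using card_not_dvd[OF p, of d] by simp
    moreover have "d \<in> {1..n}" using d \<open>k \<le> n\<close> by simp
    ultimately have "Y d \<le> G * q ^ (d div p)"
      using card_cyclic_vecs_le[of d n J a] J0 by (simp add: Y_def G_def q_def)
    also have "\<dots> \<le> G * q ^ (k div p)"
      using d q by (intro mult_le_mono2 power_increasing div_le_mono) simp_all
    finally show ?thesis by (simp flip: of_nat_power of_nat_mult)
  qed
  \<comment> \<open>Since \<open>d > k\<close>, all conditions have index below \<open>d\<close> and
    the exact count applies. Writing \<open>q - 1\<close> times \<open>q ^ (d - 1)\<close> as a
    difference makes the sum over \<open>d\<close> telescope.\<close>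
  have high: "real (Y d) = real G * (real q ^ d - real q ^ (d - 1)) / real q ^ m" if d: "d \<in> {Suc k..n}" for d
  proof -
    have "J \<subseteq> {1..<d}" using d by (auto simp: J_def)
    then have "Y d * q ^ m = G * ((q - 1) * q ^ (d - 1))"
      using card_cyclic_vecs_eq[of d n J a] J0 d by (simp add: Y_def G_def q_def cJ)
    then have "real (Y d) * real q ^ m = real G * (real (q - 1) * real q ^ (d - 1))"
      by (metis of_nat_mult of_nat_power)
    also have "real (q - 1) * real q ^ (d - 1) = real q ^ d - real q ^ (d - 1)"
      using q d by (cases d) (simp_all add: of_nat_diff algebra_simps)
    finally show ?thesis using q by (simp add: field_simps)
  qed
  have tele: "(\<Sum>d\<in>{Suc k..n}. real q ^ d - real q ^ (d - 1)) = real q ^ n - real q ^ k"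
    using \<open>k \<le> n\<close> by (rule sum_telescope'')
  \<comment> \<open>The only part not known exactly: the normalised contribution of cyclic subspaces
    of dimension at most \<open>k\<close>.\<close>
  define e where "e = (\<Sum>d\<in>{1..k}. real (Y d)) / real G"
  define x where "x = real (card (trace_set n J a)) / real G"
  have "(\<Sum>d\<in>{1..n}. real (Y d)) = (\<Sum>d\<in>{1..k}. real (Y d)) + (\<Sum>d\<in>{Suc k..n}. real (Y d))"
    using \<open>1 \<le> k\<close> \<open>k \<le> n\<close> by (subst sum.union_disjoint[symmetric]) (auto intro!: sum.cong)
  also have "(\<Sum>d\<in>{Suc k..n}. real (Y d)) = real G * ((real q ^ n - real q ^ k) / real q ^ m)"
    by (simp add: high flip: tele sum_distrib_left sum_divide_distrib)
  finally have split: "(\<Sum>d\<in>{1..n}. real (Y d)) / real G = e + (real q ^ n - real q ^ k) / real q ^ m"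
    using G by (simp add: e_def add_divide_distrib)
  have "(\<Sum>d\<in>{1..n}. Y d) = card (trace_set n J a) * (q ^ n - 1)"
    unfolding Y_def q_def using assms by (intro sum_card_cyclic_vecs) simp
  then have "(\<Sum>d\<in>{1..n}. real (Y d)) = real (card (trace_set n J a)) * (real q ^ n - 1)"
    using q by (simp add: of_nat_diff flip: of_nat_sum)
  \<comment> \<open>The factorisation of \<open>q ^ k\<close> uses \<open>m + k div p = k\<close>,
    with no truncation in \<open>m\<close> because \<open>k div p \<le> k\<close>.\<close>
  then have eq: "x * (real q ^ n - 1) = e + (real q ^ n - real q ^ m * real q ^ (k div p)) / real q ^ m"
    using split by (simp add: x_def m_def kp flip: power_add)
  have "(\<Sum>d\<in>{1..k}. real (Y d)) \<le> real k * (real G * real q ^ (k div p))"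
    using sum_bounded_above[of "{1..k}" "\<lambda>d. real (Y d)"] low by simp
  then have e: "0 \<le> e" "e \<le> real k * real q ^ (k div p)"
    using G by (simp_all add: e_def sum_nonneg field_simps)
  have "k + 1 \<le> 2 ^ n" using \<open>k \<le> n\<close> less_exp[of n] by linarith
  also have "\<dots> \<le> q ^ n" using q by (rule power_mono) simp
  finally have N: "real k + 1 \<le> real q ^ n" by (metis of_nat_1 of_nat_add of_nat_le_iff of_nat_power)
  have "\<bar>x - 1 / real q ^ m\<bar> \<le> real (k + 1) * real q ^ (k div p) / real q ^ n"
    using q by (intro recursion_bound[OF eq e _ _ N \<open>1 \<le> k\<close>]) simp_all
  then show ?thesis unfolding set x_def q_def p_def m_def G_def .
qed

end
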